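(* Let $G=\{1,2\}$, $\mathcal A\subset\mathbb N_+$ with $\gcd(\mathcal A)=1$, and let $p(g\mid\mathbf w)=\sum_{k\in\mathcal A}\theta_kP_{(k)}(w_{-k},g)$ with $P_{(k)}\in\{I_2,J_2\}$ for every $k\in\mathcal A$, where $I_2=\begin{pmatrix}1&0\\0&1\end{pmatrix}$ and $J_2=\begin{pmatrix}0&1\\1&0\end{pmatrix}$. Then $|\mathcal G(p)|=1$ if and only if either there is an even $m\in\mathcal A$ with $P_{(m)}=J_2$, or there are odd $m_1,m_2\in\mathcal A$ with $P_{(m_1)}=J_2$ and $P_{(m_2)}=I_2$.
   Context: $\theta$ is a probability distribution on $\mathcal A$ with $\theta_k>0$ for $k\in\mathcal A$; $\mathbf w=(w_{-1},w_{-2},\dots)\in G^{-\mathbb N_+}$. A law of $(X_n)_{n\in\mathbb Z}$ on $G^{\mathbb Z}$ is compatible with $p$ if $P(X_n=g\mid X_{n-1},X_{n-2},\dots)=p(g\mid X_{n-1},X_{n-2},\dots)$ a.s. for all $n\in\mathbb Z$, $g\in G$; $\mathcal G(p)$ is the set of compatible laws. *)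

theory Defs
  imports "HOL-Probability.Probability"
begin

text \<open>The alphabet G = {1,2} is represented by the type bool (True ~ 1, False ~ 2).
  A 2x2 stochastic matrix P on G is represented by its entry function P a g.\<close>

definition I2 :: "bool \<Rightarrow> bool \<Rightarrow> real" where
  "I2 a g = (if a = g then 1 else 0)"

definition J2 :: "bool \<Rightarrow> bool \<Rightarrow> real" where
  "J2 a g = (if a = g then 0 else 1)"

text \<open>The kernel p(g | w) = sum over k in A of theta k * P_k(w_{-k}, g);
  the past w = (w_{-1}, w_{-2}, ...) is encoded as w :: nat => bool with w k = w_{-k}.\<close>

definition mixkernel :: "nat set \<Rightarrow> (nat \<Rightarrow> real) \<Rightarrow> (nat \<Rightarrow> bool \<Rightarrow> bool \<Rightarrow> real)
    \<Rightarrow> bool \<Rightarrow> (nat \<Rightarrow> bool) \<Rightarrow> real" where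
  "mixkernel A \<theta> P g w = (\<Sum>\<^sub>\<infinity>k\<in>A. \<theta> k * P k (w k) g)"

definition pathspace :: "(int \<Rightarrow> bool) measure" where
  "pathspace = PiM UNIV (\<lambda>_. count_space UNIV)"

definition past :: "int \<Rightarrow> (int \<Rightarrow> bool) measure" where
  "past n = sigma (space pathspace) {{x \<in> space pathspace. x m = b} | m b. m < n}"

definition compatible :: "(bool \<Rightarrow> (nat \<Rightarrow> bool) \<Rightarrow> real) \<Rightarrow> (int \<Rightarrow> bool) measure \<Rightarrow> bool" where
  "compatible p M \<longleftrightarrow> prob_space M \<and> sets M = sets pathspace \<and>
     (\<forall>n g. AE x in M. real_cond_exp M (past n) (indicator {y. y n = g}) x
                        = p g (\<lambda>k. x (n - int k)))"

definition compatible_laws :: "(bool \<Rightarrow> (nat \<Rightarrow> bool) \<Rightarrow> real) \<Rightarrow> (int \<Rightarrow> bool) measure set" where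
  "compatible_laws p = {M. compatible p M}"

end

theory Submission
  imports Defs "HOL-Complex_Analysis.Great_Picard"
begin

text \<open>Write the states as spins \<open>\<plusminus>1\<close>. The kernel says that $X_n = \varepsilon_K X_{n-K}$ with \<open>K\<close> drawn from
  \<open>\<theta>\<close> independently of the past, where $\varepsilon_k = 1$ if $P_{(k)} = I_2$ and $-1$ otherwise. A law is
  determined by its moments $\varphi(S) = E \prod_{i\in S} X_i$ over finite sets \<open>S\<close>, and compatibility means
  that $\varphi(S \cup \{n\}) = \sum_k \theta_k \varepsilon_k\, \varphi(S \mathbin{\triangle} \{n-k\})$ whenever \<open>S\<close> lies to
  the left of \<open>n\<close>.

  If the condition fails, all $\varepsilon_k$ are 1 or all $\varepsilon_k$ are $(-1)^k$, and the Dirac laws at the two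
  constant or the two alternating paths are compatible. If it holds, there are two sequences of jumps with
  the same total displacement and opposite signs, which forces solutions of the one-point equation on a
  half-line to decay uniformly. For the difference of two moment functions, argue by induction on the
  cardinality: where the largest element of \<open>S\<close> is far from the others, the difference is small by decay;
  where it is close to the second largest, near-maximality would propagate along jumps until these two
  elements cancel, contradicting the induction hypothesis. Existence holds in all cases: resample
  the sites $-m, \dots, m$ one after the other from the kernel and take a limit point as \<open>m\<close> grows.\<close>

section \<open>Signed recursions\<close>

definition spin :: "bool \<Rightarrow> real" where
  "spin b = (if b then 1 else - 1)"

text \<open>Symmetric difference with \<open>{a}\<close>. Since spins square to 1, multiplying a
  product of spins by the spin at \<open>a\<close> changes its index set in this way.\<close>

definition toggle :: "'a \<Rightarrow> 'a set \<Rightarrow> 'a set" where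
  "toggle a S = (if a \<in> S then S - {a} else insert a S)"

lemma abs_spin [simp]: "\<bar>spin b\<bar> = 1"
  by (simp add: spin_def)

lemma spin_eq_iff: "spin (a = b) = spin a * spin b"
  by (simp add: spin_def)

lemma finite_toggle [simp]: "finite (toggle a S) \<longleftrightarrow> finite S"
  by (simp add: toggle_def)

lemma card_toggle_le: "finite S \<Longrightarrow> card (toggle a S) \<le> Suc (card S)"
  by (auto simp: toggle_def card_insert_if intro: le_SucI card_Diff1_le)

text \<open>The differences of sums over two lists from \<open>A\<close> form a subgroup of the
  integers containing \<open>A\<close>. By division with remainder its least positive element
  divides every element of \<open>A\<close>, hence also the gcd 1, so the subgroup is
  everything.\<close>

lemma combinations_of_coprime_set:
  fixes A :: "nat set"
  assumes "Gcd A = 1"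
  obtains l1 l2 where "set l1 \<subseteq> A" "set l2 \<subseteq> A" "sum_list l1 = sum_list l2 + g"
proof -
  define H where "H = {z::int. \<exists>l1 l2. set l1 \<subseteq> A \<and> set l2 \<subseteq> A \<and> z = int (sum_list l1) - int (sum_list l2)}"
  have add: "x + y \<in> H" if "x \<in> H" "y \<in> H" for x y
  proof -
    from that obtain l1 l2 l1' l2' where "set l1 \<subseteq> A" "set l2 \<subseteq> A" "x = int (sum_list l1) - int (sum_list l2)"
      "set l1' \<subseteq> A" "set l2' \<subseteq> A" "y = int (sum_list l1') - int (sum_list l2')"
      unfolding H_def by blast
    then show ?thesis unfolding H_def
      by (intro CollectI exI[of _ "l1 @ l1'"] exI[of _ "l2 @ l2'"]) auto
  qed
  have neg: "- x \<in> H" if "x \<in> H" for x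
    using that unfolding H_def by force
  have A: "int a \<in> H" if "a \<in> A" for a
    using that unfolding H_def by (intro CollectI exI[of _ "[a]"] exI[of _ "[]"]) auto
  have zero: "0 \<in> H"
    unfolding H_def by (intro CollectI exI[of _ "[]"]) auto
  have mult_nat: "int n * x \<in> H" if "x \<in> H" for n x
    by (induction n) (auto simp: zero algebra_simps that add)
  have mult: "k * x \<in> H" if "x \<in> H" for k x
    using mult_nat[OF that] neg by (cases k rule: int_cases2) fastforce+
  obtain a where a: "a \<in> A" "a \<noteq> 0"
    using assms by (metis Gcd_0_iff subsetI singletonI singleton_iff zero_neq_one)
  define h where "h = (LEAST n. n > 0 \<and> int n \<in> H)"
  have h: "h > 0" "int h \<in> H"
    using LeastI[of "\<lambda>n. n > 0 \<and> int n \<in> H" a] a A unfolding h_def by auto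
  have "h dvd b" if "b \<in> A" for b
  proof -
    have "int (b mod h) = int b + (- (int b div int h)) * int h"
      using minus_div_mult_eq_mod[of "int b" "int h"] unfolding zmod_int by linarith
    then have "int (b mod h) \<in> H"
      using add[OF A[OF that] mult[OF h(2)]] by metis
    moreover have "b mod h < h"
      using h by simp
    ultimately have "b mod h = 0"
      using not_less_Least[of "b mod h" "\<lambda>n. n > 0 \<and> int n \<in> H"] unfolding h_def by auto
    then show ?thesis by auto
  qed
  then have "h dvd 1"
    using assms Gcd_greatest by metis
  then have "int g \<in> H"
    using mult[OF h(2), of "int g"] by simp
  then show thesis
    using that unfolding H_def by auto
qed

text \<open>\<open>\<kappa>\<close> is the law of the lag; \<open>s k\<close> says that lag
  \<open>k\<close> copies the state, its negation that lag \<open>k\<close> flips it. Taking the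
  weights as a \<open>pmf\<close> turns sums over lags into expectations.\<close>

locale spin_mixture =
  fixes \<kappa> :: "nat pmf" and s :: "nat \<Rightarrow> bool"
  assumes zero_notin: "0 \<notin> set_pmf \<kappa>"
begin

abbreviation E :: "(nat \<Rightarrow> real) \<Rightarrow> real" where
  "E \<equiv> measure_pmf.expectation \<kappa>"

abbreviation e :: "nat \<Rightarrow> real" where
  "e k \<equiv> spin (s k)"

lemma integrable_bounded: "(\<And>k. \<bar>f k\<bar> \<le> (B::real)) \<Longrightarrow> integrable (measure_pmf \<kappa>) f"
  by (intro measure_pmf.integrable_const_bound[where B=B]) auto

lemma integrable_indicators:
  "integrable (measure_pmf \<kappa>) (indicator A :: nat \<Rightarrow> real)"
  by (intro integrable_bounded[where B=1]) (auto simp: indicator_def)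

lemma abs_e_mult [simp]: "\<bar>e k * x\<bar> = \<bar>x\<bar>"
  by (simp add: abs_mult)

lemma e_mult_le: "\<bar>x\<bar> \<le> B \<Longrightarrow> e k * x \<le> B"
  using abs_e_mult[of k x] by linarith

text \<open>The value at \<open>k\<close> is kept while all other lags are bounded crudely, with an
  excess of 1 allowed beyond \<open>q\<close>. This is one step of following a prescribed sequence
  of jumps.\<close>

lemma expectation_le_single:
  assumes "\<And>j. \<bar>f j\<bar> \<le> C" "\<And>j. f j \<le> B + indicator {q<..} j"
  shows "E f \<le> B + measure_pmf.prob \<kappa> {q<..} + pmf \<kappa> k * (f k - B)"
proof -
  have "E f \<le> E (\<lambda>j. B + indicator {q<..} j + indicator {k} j * (f k - B))"
  proof (rule integral_mono)
    show "integrable (measure_pmf \<kappa>) f"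
      using assms(1) by (rule integrable_bounded)
    show "integrable (measure_pmf \<kappa>) (\<lambda>j. B + indicator {q<..} j + indicator {k} j * (f k - B))"
      by (intro integrable_bounded[where B="\<bar>B\<bar> + 1 + \<bar>f k - B\<bar>"]) (auto simp: indicator_def)
    show "f j \<le> B + indicator {q<..} j + indicator {k} j * (f k - B)" for j
      using assms(2)[of j] by (auto simp: indicator_def)
  qed
  also have "\<dots> = B + measure_pmf.prob \<kappa> {q<..} + pmf \<kappa> k * (f k - B)"
    by (simp add: integrable_indicators measure_pmf_single)
  finally show ?thesis .
qed

section \<open>Decay of solutions of the one-point equation on a half-line\<close>

definition harmonic_at :: "(int \<Rightarrow> real) \<Rightarrow> int \<Rightarrow> bool" where
  "harmonic_at u n \<longleftrightarrow> u n = E (\<lambda>k. e k * u (n - int k))"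

definition jump_sign :: "nat list \<Rightarrow> real" where
  "jump_sign l = prod_list (map e l)"

definition jump_weight :: "nat list \<Rightarrow> real" where
  "jump_weight l = prod_list (map (pmf \<kappa>) l)"

lemma jump_weight_pos: "set l \<subseteq> set_pmf \<kappa> \<Longrightarrow> jump_weight l > 0"
  by (induction l) (auto simp: jump_weight_def pmf_positive)

lemma harmonic_at_uminus: "harmonic_at u n \<Longrightarrow> harmonic_at (\<lambda>m. - u m) n"
  by (simp add: harmonic_at_def)

lemma harmonic_at_e_mult: "harmonic_at u n \<Longrightarrow> harmonic_at (\<lambda>m. e k * u m) n"
  using harmonic_at_uminus by (auto simp: spin_def)

text \<open>The harmonic equation is unfolded once per jump of \<open>l\<close>. Each time, lags up
  to \<open>q\<close> land at or beyond \<open>d\<close>, where \<open>B\<close> bounds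
  \<open>u\<close>, and longer lags cost at most their probability; \<open>n\<close> lies far enough
  to the right for this to persist along the whole path.\<close>

lemma jump_bound:
  assumes "\<And>m. \<bar>u m\<bar> \<le> 1" "0 \<le> B" "\<And>m. m \<ge> int d \<Longrightarrow> \<bar>u m\<bar> \<le> B"
    and "\<And>m. m > 0 \<Longrightarrow> harmonic_at u m"
    and "n \<ge> int (d + q + sum_list l + 1)"
  shows "u n \<le> B + real (length l) * measure_pmf.prob \<kappa> {q<..}
           + jump_weight l * (jump_sign l * u (n - int (sum_list l)) - B)"
  using assms
proof (induction l arbitrary: u n)
  case Nil
  then show ?case by (simp add: jump_weight_def jump_sign_def)
next
  case (Cons k l)
  let ?\<tau> = "measure_pmf.prob \<kappa> {q<..}"
  \<comment> \<open>The sign of the first jump is absorbed into the function, which stays harmonic,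
    so the induction hypothesis applies to \<open>?u\<close>.\<close>
  let ?u = "\<lambda>m. e k * u m"
  have n: "n > 0" using Cons.prems(5) by simp
  have "u n = E (\<lambda>j. e j * u (n - int j))"
    using Cons.prems(4)[OF n] by (simp add: harmonic_at_def)
  also have "\<dots> \<le> B + ?\<tau> + pmf \<kappa> k * (e k * u (n - int k) - B)"
  proof (rule expectation_le_single)
    show "\<bar>e j * u (n - int j)\<bar> \<le> 1" for j
      using Cons.prems(1) by simp
    show "e j * u (n - int j) \<le> B + indicator {q<..} j" for j
    proof (cases "j \<le> q")
      case True
      then have "n - int j \<ge> int d" using Cons.prems(5) by simp
      then show ?thesis using True by (auto intro!: e_mult_le Cons.prems(3))
    next
      case False
      have "e j * u (n - int j) \<le> 1" by (intro e_mult_le Cons.prems(1))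
      then show ?thesis using False Cons.prems(2) by simp
    qed
  qed
  also have "pmf \<kappa> k * (e k * u (n - int k) - B)
     \<le> pmf \<kappa> k * (real (length l) * ?\<tau> + jump_weight l * (jump_sign l * ?u (n - int k - int (sum_list l)) - B))"
  proof (rule mult_left_mono)
    have "?u (n - int k) \<le> B + real (length l) * ?\<tau>
           + jump_weight l * (jump_sign l * ?u (n - int k - int (sum_list l)) - B)"
      by (rule Cons.IH) (use Cons.prems in \<open>auto simp: harmonic_at_e_mult\<close>)
    then show "e k * u (n - int k) - B \<le> real (length l) * ?\<tau> + jump_weight l * (jump_sign l * ?u (n - int k - int (sum_list l)) - B)"
      by simp
  qed auto
  also have "\<dots> \<le> real (length l) * ?\<tau> + pmf \<kappa> k * (jump_weight l * (jump_sign l * ?u (n - int k - int (sum_list l)) - B))"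
    using mult_right_mono[OF pmf_le_1, of "real (length l) * ?\<tau>" \<kappa> k] by (simp add: distrib_left)
  finally show ?case
    by (simp add: jump_weight_def jump_sign_def algebra_simps)
qed

lemma tail_prob_tendsto_0: "(\<lambda>q. measure_pmf.prob \<kappa> {q<..}) \<longlonglongrightarrow> 0"
proof -
  have "(\<lambda>q. measure_pmf.prob \<kappa> {q<..}) \<longlonglongrightarrow> measure_pmf.prob \<kappa> (\<Inter>q. {q<..})"
    by (intro measure_pmf.finite_Lim_measure_decseq) (auto simp: decseq_def)
  also have "(\<Inter>q. {q<..}) = ({}::nat set)"
    by auto
  finally show ?thesis by simp
qed

definition cancelling :: "nat list \<Rightarrow> nat list \<Rightarrow> bool" where
  "cancelling l1 l2 \<longleftrightarrow> set l1 \<subseteq> set_pmf \<kappa> \<and> set l2 \<subseteq> set_pmf \<kappa> \<and> sum_list l1 = sum_list l2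
     \<and> jump_sign l1 = 1 \<and> jump_sign l2 = - 1"

definition half_line :: "(int \<Rightarrow> real) set" where
  "half_line = {u. (\<forall>m. \<bar>u m\<bar> \<le> 1) \<and> (\<forall>m>0. harmonic_at u m)}"

text \<open>The supremum runs over all of \<open>half_line\<close>, whose members are arbitrary up
  to site 0 within the bound 1. Decay of \<open>envelope\<close> is therefore uniform in the
  boundary data.\<close>

definition envelope :: "nat \<Rightarrow> real" where
  "envelope d = (SUP (u, n) \<in> half_line \<times> {int d..}. \<bar>u n\<bar>)"

lemma envelope_bdd: "bdd_above ((\<lambda>(u, n). \<bar>u n\<bar>) ` (half_line \<times> {int d..}))"
  by (intro bdd_aboveI[where M=1]) (auto simp: half_line_def)

lemma half_line_nonempty: "(\<lambda>_. 0) \<in> half_line"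
  by (simp add: half_line_def harmonic_at_def)

lemma le_envelope: "u \<in> half_line \<Longrightarrow> n \<ge> int d \<Longrightarrow> \<bar>u n\<bar> \<le> envelope d"
  unfolding envelope_def using envelope_bdd[of d] by (force intro: cSUP_upper2)

lemma envelope_least: "(\<And>u n. u \<in> half_line \<Longrightarrow> n \<ge> int d \<Longrightarrow> \<bar>u n\<bar> \<le> B) \<Longrightarrow> envelope d \<le> B"
  unfolding envelope_def using half_line_nonempty by (intro cSUP_least) auto

lemma envelope_nonneg: "envelope d \<ge> 0"
  using le_envelope[OF half_line_nonempty, of d "int d"] by simp

lemma envelope_decseq: "decseq envelope"
  unfolding decseq_def by (auto intro!: envelope_least le_envelope)

lemma half_line_uminus: "u \<in> half_line \<Longrightarrow> (\<lambda>m. - u m) \<in> half_line"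
  by (simp add: half_line_def harmonic_at_uminus)

text \<open>Two jump paths with the same displacement and opposite signs force a definite amount of
  cancellation, so the envelope contracts up to the probability of jumping out of the window.\<close>

lemma envelope_tendsto_0:
  assumes "cancelling l1 l2"
  shows "envelope \<longlonglongrightarrow> 0"
proof -
  obtain a where a: "envelope \<longlonglongrightarrow> a"
    using decseq_convergent[OF envelope_decseq, of 0] envelope_nonneg by metis
  define c where "c = min (jump_weight l1) (jump_weight l2)"
  define N where "N = length l1 + length l2"
  define x where "x = sum_list l1"
  let ?\<tau> = "\<lambda>q. measure_pmf.prob \<kappa> {q<..}"
  have c: "c > 0" "jump_weight l1 \<ge> c" "jump_weight l2 \<ge> c"
    using assms jump_weight_pos by (auto simp: c_def cancelling_def)
  have upper: "u n \<le> (1 - c) * envelope d + real N * ?\<tau> q"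
    if u: "u \<in> half_line" and n: "n \<ge> int (d + q + x + 1)" for u n d q
  proof -
    define v where "v = u (n - int x)"
    have "u n \<le> envelope d + real (length l) * ?\<tau> q
           + jump_weight l * (jump_sign l * u (n - int (sum_list l)) - envelope d)"
      if "sum_list l = x" for l
      using u n that by (intro jump_bound envelope_nonneg) (auto simp: half_line_def intro: le_envelope[OF u])
    from this[of l1] this[of l2] assms
    have 1: "u n \<le> envelope d + real (length l1) * ?\<tau> q + jump_weight l1 * (v - envelope d)"
      and 2: "u n \<le> envelope d + real (length l2) * ?\<tau> q + jump_weight l2 * (- v - envelope d)"
      by (auto simp: cancelling_def x_def v_def)
    have \<tau>: "real (length l1) * ?\<tau> q \<le> real N * ?\<tau> q" "real (length l2) * ?\<tau> q \<le> real N * ?\<tau> q"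
      by (auto simp: N_def intro!: mult_right_mono)
    have neg: "j * (y - envelope d) \<le> - (c * envelope d)" if "j \<ge> c" "y \<le> 0" for j y
    proof -
      have "j * (envelope d - y) \<ge> c * envelope d"
        using that c(1) envelope_nonneg[of d] by (intro mult_mono) auto
      then show ?thesis by (simp add: algebra_simps)
    qed
    \<comment> \<open>The two paths end at the same site with opposite signs, so one of
      \<open>v\<close> and \<open>- v\<close> is at most 0; the bound along that path loses at least
      \<open>c * envelope d\<close>.\<close>
    show ?thesis
    proof (cases "v \<le> 0")
      case True
      then show ?thesis using 1 \<tau> neg[OF c(2) True] by (simp add: algebra_simps)
    next
      case False
      then show ?thesis using 2 \<tau> neg[OF c(3), of "- v"] by (simp add: algebra_simps)
    qed
  qed
  have contr: "envelope (d + q + x + 1) \<le> (1 - c) * envelope d + real N * ?\<tau> q" for d q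
  proof (rule envelope_least)
    fix u n assume "u \<in> half_line" "n \<ge> int (d + q + x + 1)"
    with upper[OF this] upper[OF half_line_uminus this(2)]
    show "\<bar>u n\<bar> \<le> (1 - c) * envelope d + real N * ?\<tau> q" by (simp add: abs_le_iff)
  qed
  \<comment> \<open>First \<open>d\<close> tends to infinity with the window \<open>q\<close> fixed,
    then \<open>q\<close> does. The tail term vanishes in the second limit, leaving
    \<open>a \<le> (1 - c) * a\<close>.\<close>
  have "a \<le> (1 - c) * a + real N * ?\<tau> q" for q
  proof (rule LIMSEQ_le)
    show "(\<lambda>d. envelope (d + (q + x + 1))) \<longlonglongrightarrow> a"
      using a by (rule LIMSEQ_ignore_initial_segment)
    show "(\<lambda>d. (1 - c) * envelope d + real N * ?\<tau> q) \<longlonglongrightarrow> (1 - c) * a + real N * ?\<tau> q"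
      by (intro tendsto_intros a)
    show "\<exists>d0. \<forall>d\<ge>d0. envelope (d + (q + x + 1)) \<le> (1 - c) * envelope d + real N * ?\<tau> q"
      using contr by (auto simp: add.assoc)
  qed
  moreover have "(\<lambda>q. (1 - c) * a + real N * ?\<tau> q) \<longlonglongrightarrow> (1 - c) * a + real N * 0"
    by (intro tendsto_intros tail_prob_tendsto_0)
  ultimately have "a \<le> (1 - c) * a"
    by (intro LIMSEQ_le_const[where X="\<lambda>q. (1 - c) * a + real N * ?\<tau> q"]) auto
  then have "c * a \<le> 0" by (simp add: algebra_simps)
  then have "a \<le> 0" using c(1) by (simp add: mult_le_0_iff)
  moreover have "a \<ge> 0"
    using a envelope_nonneg by (intro LIMSEQ_le_const) auto
  ultimately show ?thesis using a by simp
qed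

text \<open>Translation by \<open>n0\<close> moves the boundary to 0, so a bound on
  \<open>envelope\<close> supplies one \<open>d\<close> for all functions and all
  boundaries.\<close>

lemma harmonic_decay:
  assumes "cancelling l1 l2" "\<delta> > 0"
  obtains d :: nat where
    "\<And>u n0 n. \<lbrakk>\<And>m. \<bar>u m\<bar> \<le> 1; \<And>m. m > n0 \<Longrightarrow> harmonic_at u m; n \<ge> n0 + int d\<rbrakk> \<Longrightarrow> \<bar>u n\<bar> \<le> \<delta>"
proof -
  obtain d where d: "envelope d < \<delta>"
    using order_tendstoD(2)[OF envelope_tendsto_0[OF assms(1)] assms(2)]
    by (auto simp: eventually_sequentially)
  have "\<bar>u n\<bar> \<le> \<delta>" if "\<And>m. \<bar>u m\<bar> \<le> 1" "\<And>m. m > n0 \<Longrightarrow> harmonic_at u m" "n \<ge> n0 + int d" for u n0 n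
  proof -
    have "(\<lambda>m. u (m + n0)) \<in> half_line"
      using that(1,2) by (auto simp: half_line_def harmonic_at_def algebra_simps)
    from le_envelope[OF this, of d "n - n0"] that(3) d show ?thesis by simp
  qed
  then show thesis using that by blast
qed

section \<open>Uniqueness for the recursion over finite sets of sites\<close>

definition recursive :: "(int set \<Rightarrow> real) \<Rightarrow> int \<Rightarrow> bool" where
  "recursive F n \<longleftrightarrow>
     (\<forall>S. finite S \<longrightarrow> S \<subseteq> {..<n} \<longrightarrow> F (insert n S) = E (\<lambda>k. e k * F (toggle (n - int k) S)))"

text \<open>In the recursion at the largest element every term is bounded by \<open>M\<close>, since
  toggling adds at most one site to the remaining ones. Hence a deficit below \<open>M\<close> after
  the move by \<open>k\<close> is inherited by \<open>F S\<close> with factor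
  \<open>pmf \<kappa> k\<close>.\<close>

lemma move_top_bound:
  assumes F: "\<And>n. recursive F n" "\<And>S. finite S \<Longrightarrow> card S \<le> r \<Longrightarrow> \<bar>F S\<bar> \<le> M"
    and S: "finite S" "card S = r" "S \<noteq> {}"
  shows "\<bar>F S\<bar> \<le> M + pmf \<kappa> k * (\<bar>F (toggle (Max S - int k) (S - {Max S}))\<bar> - M)"
proof -
  define n where "n = Max S"
  define T where "T = S - {n}"
  have n: "n \<in> S" using S by (simp add: n_def)
  have "x < n" if "x \<in> T" for x
    using that S by (simp add: T_def n_def order.strict_iff_order)
  then have T: "finite T" "T \<subseteq> {..<n}" "insert n T = S" "Suc (card T) = r"
    using S n card_Suc_Diff1[of S n] by (auto simp: T_def)
  have bd: "\<bar>F (toggle m T)\<bar> \<le> M" for m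
    using card_toggle_le[OF T(1), of m] T by (intro F(2)) auto
  have upper: "E (\<lambda>j. \<sigma> * (e j * F (toggle (n - int j) T)))
      \<le> M + pmf \<kappa> k * (\<bar>F (toggle (n - int k) T)\<bar> - M)" if "\<sigma> = 1 \<or> \<sigma> = - 1" for \<sigma>
  proof -
    have ab: "\<bar>\<sigma> * (e j * x)\<bar> = \<bar>x\<bar>" for j x using that by (auto simp: abs_mult)
    have "E (\<lambda>j. \<sigma> * (e j * F (toggle (n - int j) T))) = E (\<lambda>j. min M (\<sigma> * (e j * F (toggle (n - int j) T))))"
      using bd ab by (intro arg_cong[of _ _ E] ext min.absorb2[symmetric]) (metis abs_le_D1)
    also have "\<dots> \<le> E (\<lambda>j. M + indicator {k} j * (\<bar>F (toggle (n - int k) T)\<bar> - M))"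
    proof (rule integral_mono)
      have "M \<ge> 0" using bd[of 0] by linarith
      then show "integrable (measure_pmf \<kappa>) (\<lambda>j. min M (\<sigma> * (e j * F (toggle (n - int j) T))))"
        using bd ab by (intro integrable_bounded[where B=M]) (simp add: min_def)
      show "integrable (measure_pmf \<kappa>) (\<lambda>j. M + indicator {k} j * (\<bar>F (toggle (n - int k) T)\<bar> - M))"
        by (intro integrable_bounded[where B="\<bar>M\<bar> + \<bar>\<bar>F (toggle (n - int k) T)\<bar> - M\<bar>"]) (auto simp: indicator_def)
      show "min M (\<sigma> * (e j * F (toggle (n - int j) T)))
          \<le> M + indicator {k} j * (\<bar>F (toggle (n - int k) T)\<bar> - M)" for j
        using ab[of j "F (toggle (n - int j) T)"] by (auto simp: indicator_def)
    qed
    also have "\<dots> = M + pmf \<kappa> k * (\<bar>F (toggle (n - int k) T)\<bar> - M)"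
      by (simp add: integrable_indicators measure_pmf_single)
    finally show ?thesis .
  qed
  have "F S = E (\<lambda>j. e j * F (toggle (n - int j) T))"
    using F(1)[of n, unfolded recursive_def, rule_format, OF T(1,2)] unfolding T(3) .
  with upper[of 1] upper[of "- 1"] show ?thesis
    by (auto simp: abs_le_iff n_def T_def)
qed

text \<open>The paths \<open>l1\<close> and \<open>l2\<close> lead \<open>a\<close> and \<open>b\<close> to a common site \<open>z\<close>. Moving always the largest element,
  the total height above \<open>z\<close> decreases, so some two elements must annihilate within \<open>m\<close> moves.\<close>

lemma merge_bound:
  assumes F: "\<And>n. recursive F n" "\<And>S. finite S \<Longrightarrow> card S \<le> r \<Longrightarrow> \<bar>F S\<bar> \<le> M"
      "\<And>S. finite S \<Longrightarrow> card S < r \<Longrightarrow> F S = 0"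
    and K: "K \<subseteq> set_pmf \<kappa>" "\<And>k. k \<in> K \<Longrightarrow> c \<le> pmf \<kappa> k" "0 < c" "c \<le> 1"
    and "0 \<le> M"
    and "finite S" "card S = r" "a \<in> S" "b \<in> S" "a \<noteq> b" "set l1 \<subseteq> K" "set l2 \<subseteq> K"
      "a - int (sum_list l1) = z" "b - int (sum_list l2) = z" "(\<Sum>x\<in>S. nat (x - z)) \<le> m"
  shows "\<bar>F S\<bar> \<le> M * (1 - c ^ m)"
  using assms(9-)
proof (induction m arbitrary: S a b l1 l2)
  case (0 S a b l1 l2)
  \<comment> \<open>Both \<open>a\<close> and \<open>b\<close> lie at or above \<open>z\<close>, so
    total height 0 puts both at \<open>z\<close>, against \<open>a \<noteq> b\<close>.\<close>
  then have "nat (a - z) = 0" "nat (b - z) = 0" by (auto simp: sum_eq_0_iff)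
  then show ?case using 0 by auto
next
  case (Suc m S a b l1 l2)
  define n where "n = Max S"
  have S: "S \<noteq> {}" using Suc.prems by auto
  have n: "n \<in> S" "\<And>x. x \<in> S \<Longrightarrow> x \<le> n"
    using Suc.prems S by (auto simp: n_def)
  have "n > z"
  proof (rule ccontr)
    assume "\<not> n > z"
    then have "a \<le> z" "b \<le> z" using n(2)[OF Suc.prems(3)] n(2)[OF Suc.prems(4)] by auto
    then show False using Suc.prems(5,8,9) by auto
  qed
  define T where "T = S - {n}"
  have T: "finite T" "card T = r - 1" "n \<notin> T" "S = insert n T"
    using Suc.prems n by (auto simp: T_def)
  have r: "r \<ge> 1" using Suc.prems(1,2) S by (metis One_nat_def Suc_leI card_gt_0_iff)
  \<comment> \<open>Moving the top element by \<open>k\<close> either hits an occupied site, where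
    the two elements annihilate and \<open>F\<close> vanishes on the smaller set, or yields a set
    with the bound \<open>next_bound\<close>. Either way the deficit is at least
    \<open>M * c ^ m\<close>, and at least the fraction \<open>c\<close> of it passes to
    \<open>S\<close>.\<close>
  have step: "\<bar>F S\<bar> \<le> M * (1 - c ^ Suc m)"
    if k: "k \<in> K" and next_bound: "n - int k \<notin> T \<Longrightarrow> \<bar>F (insert (n - int k) T)\<bar> \<le> M * (1 - c ^ m)" for k
  proof -
    have "\<bar>F (toggle (n - int k) T)\<bar> \<le> M * (1 - c ^ m)"
    proof (cases "n - int k \<in> T")
      case True
      then have "card (T - {n - int k}) < r"
        using T r by (metis One_nat_def card_Diff1_less diff_le_self order_less_le_trans)
      then have "F (T - {n - int k}) = 0" using T by (intro F(3)) auto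
      then show ?thesis using True K(3,4) \<open>0 \<le> M\<close> by (simp add: toggle_def power_le_one)
    qed (use next_bound in \<open>simp add: toggle_def\<close>)
    then have "\<bar>F (toggle (n - int k) T)\<bar> - M \<le> - (M * c ^ m)"
      by (simp add: algebra_simps)
    then have "pmf \<kappa> k * (\<bar>F (toggle (n - int k) T)\<bar> - M) \<le> pmf \<kappa> k * (- (M * c ^ m))"
      by (rule mult_left_mono) simp
    also have "\<dots> \<le> c * (- (M * c ^ m))"
      using K(2)[OF k] K(3) \<open>0 \<le> M\<close> by (auto intro!: mult_right_mono)
    finally show ?thesis
      using move_top_bound[OF F(1,2) Suc.prems(1,2) S, where k=k] unfolding n_def T_def
      by (simp add: algebra_simps)
  qed
  have sum_less: "(\<Sum>x\<in>insert (n - int k) T. nat (x - z)) \<le> m" if "k \<in> K" "n - int k \<notin> T" for k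
  proof -
    have "k > 0" using that(1) K(1) zero_notin by (metis gr0I subsetD)
    then have "nat (n - int k - z) < nat (n - z)" using \<open>n > z\<close> by auto
    moreover have "(\<Sum>x\<in>S. nat (x - z)) = nat (n - z) + (\<Sum>x\<in>T. nat (x - z))"
      using T by simp
    moreover have "(\<Sum>x\<in>insert (n - int k) T. nat (x - z)) = nat (n - int k - z) + (\<Sum>x\<in>T. nat (x - z))"
      using T that(2) by simp
    ultimately show ?thesis using Suc.prems(10) by linarith
  qed
  have card: "card (insert (n - int k) T) = r" if "n - int k \<notin> T" for k
    using that T r by simp
  consider "n = a" | "n = b" | "n \<noteq> a" "n \<noteq> b" by blast
  then show ?case
  proof cases
    case 1
    \<comment> \<open>A top element \<open>a\<close> above \<open>z\<close> still has jumps left in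
      \<open>l1\<close>, and the next of them is the move made.\<close>
    with \<open>n > z\<close> Suc.prems obtain k l where l: "l1 = k # l" by (cases l1) auto
    show ?thesis
    proof (rule step)
      show "k \<in> K" using l Suc.prems by simp
      assume "n - int k \<notin> T"
      then show "\<bar>F (insert (n - int k) T)\<bar> \<le> M * (1 - c ^ m)"
        using Suc.prems l T 1 sum_less card \<open>k \<in> K\<close>
        by (intro Suc.IH[of _ "n - int k" b l l2]) auto
    qed
  next
    case 2
    with \<open>n > z\<close> Suc.prems obtain k l where l: "l2 = k # l" by (cases l2) auto
    show ?thesis
    proof (rule step)
      show "k \<in> K" using l Suc.prems by simp
      assume "n - int k \<notin> T"
      then show "\<bar>F (insert (n - int k) T)\<bar> \<le> M * (1 - c ^ m)"
        using Suc.prems l T 2 sum_less card \<open>k \<in> K\<close>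
        by (intro Suc.IH[of _ a "n - int k" l1 l]) auto
    qed
  next
    case 3
    \<comment> \<open>The top element is a bystander here and may be moved by any lag in
      \<open>K\<close>. One exists: \<open>a\<close> and \<open>b\<close> differ, so their paths to
      \<open>z\<close> are not both empty.\<close>
    have "l1 \<noteq> [] \<or> l2 \<noteq> []" using Suc.prems by auto
    then obtain k where k: "k \<in> K" using Suc.prems by (metis list.set_sel(1) subsetD)
    show ?thesis
    proof (rule step[OF k])
      assume "n - int k \<notin> T"
      then show "\<bar>F (insert (n - int k) T)\<bar> \<le> M * (1 - c ^ m)"
        using Suc.prems T 3 sum_less[OF k] card
        by (intro Suc.IH[of _ a b l1 l2]) auto
    qed
  qed
qed

text \<open>Coprimality yields two jump sequences whose displacements differ by
  \<open>Suc g\<close>, so the largest element and the one at distance \<open>Suc g\<close> below it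
  can be led to a common site. The sequences do not depend on \<open>S\<close>, which makes the loss
  uniform over all sets of size \<open>r\<close> with this gap.\<close>

lemma gap_bound:
  assumes F: "\<And>n. recursive F n" "\<And>S. finite S \<Longrightarrow> card S \<le> r \<Longrightarrow> \<bar>F S\<bar> \<le> M"
      "\<And>S. finite S \<Longrightarrow> card S < r \<Longrightarrow> F S = 0"
    and gcd: "Gcd (set_pmf \<kappa>) = 1" and M: "M > 0"
  shows "\<exists>\<epsilon>>0. \<forall>S. finite S \<longrightarrow> card S = r \<longrightarrow> S \<noteq> {} \<longrightarrow> Max S - int (Suc g) \<in> S \<longrightarrow> \<bar>F S\<bar> \<le> M - \<epsilon>"
proof -
  obtain l1 l2 where l: "set l1 \<subseteq> set_pmf \<kappa>" "set l2 \<subseteq> set_pmf \<kappa>" "sum_list l1 = sum_list l2 + Suc g"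
    using combinations_of_coprime_set[OF gcd] .
  define K where "K = set l1 \<union> set l2"
  define c where "c = Min (pmf \<kappa> ` K)"
  have K: "K \<subseteq> set_pmf \<kappa>" "finite K" "K \<noteq> {}"
    using l by (auto simp: K_def)
  have c: "0 < c" "\<And>k. k \<in> K \<Longrightarrow> c \<le> pmf \<kappa> k" "c \<le> 1"
  proof -
    show "c > 0" using K by (auto simp: c_def pmf_positive)
    show le: "c \<le> pmf \<kappa> k" if "k \<in> K" for k using K that by (simp add: c_def)
    show "c \<le> 1" using K(3) le pmf_le_1 by (meson ex_in_conv order_trans)
  qed
  \<comment> \<open>Each element of \<open>S\<close> is at most \<open>Max S\<close>, hence at most
    \<open>sum_list l1\<close> above the meeting site; this bounds the total height by
    \<open>m\<close> for every \<open>S\<close> of size \<open>r\<close>.\<close>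
  define m where "m = r * sum_list l1"
  have "\<bar>F S\<bar> \<le> M - M * c ^ m" if S: "finite S" "card S = r" "S \<noteq> {}" "Max S - int (Suc g) \<in> S" for S
  proof -
    define z where "z = Max S - int (sum_list l1)"
    have "(\<Sum>x\<in>S. nat (x - z)) \<le> (\<Sum>x\<in>S. sum_list l1)"
    proof (rule sum_mono)
      fix x assume "x \<in> S"
      then have "x \<le> Max S" using S by simp
      then show "nat (x - z) \<le> sum_list l1" by (simp add: z_def)
    qed
    then have "(\<Sum>x\<in>S. nat (x - z)) \<le> m" using S by (simp add: m_def)
    then have "\<bar>F S\<bar> \<le> M * (1 - c ^ m)"
      using S K l M c
      by (intro merge_bound[OF F K(1) c(2) c(1) c(3), where a="Max S" and b="Max S - int (Suc g)" and ?l1.0=l1 and ?l2.0=l2 and z=z])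
         (auto simp: z_def K_def)
    then show ?thesis by (simp add: algebra_simps)
  qed
  then show ?thesis using M c by (intro exI[of _ "M * c ^ m"]) auto
qed

text \<open>With the lower sites \<open>T\<close> fixed, the recursion becomes the one-point
  equation to the right of \<open>T\<close>; \<open>toggle\<close> gives the right value also where
  a lag lands inside \<open>T\<close>.\<close>

lemma recursive_harmonic:
  assumes "\<And>n. recursive F n" "finite T" "T \<subseteq> {..<m}"
  shows "harmonic_at (\<lambda>n. F (toggle n T)) m"
proof -
  have "toggle m T = insert m T" using assms by (auto simp: toggle_def)
  then show ?thesis using assms by (simp add: harmonic_at_def recursive_def)
qed

theorem recursive_eq_0:
  assumes canc: "cancelling l1 l2" and gcd: "Gcd (set_pmf \<kappa>) = 1"
    and F: "\<And>n. recursive F n" "\<And>S. finite S \<Longrightarrow> \<bar>F S\<bar> \<le> 1" "F {} = 0"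
  shows "finite (S :: int set) \<Longrightarrow> F S = 0"
proof (induction "card S" arbitrary: S rule: less_induct)
  case less
  show ?case
  proof (cases "S = {}")
    case False
    define r where "r = card S"
    define \<S> where "\<S> = {T :: int set. finite T \<and> card T = r \<and> T \<noteq> {}}"
    define M where "M = (SUP T\<in>\<S>. \<bar>F T\<bar>)"
    have S: "S \<in> \<S>" using less False by (simp add: \<S>_def r_def)
    have bdd: "bdd_above ((\<lambda>T. \<bar>F T\<bar>) ` \<S>)"
      using F(2) by (auto simp: \<S>_def intro!: bdd_aboveI[where M=1])
    have le_M: "\<bar>F T\<bar> \<le> M" if "T \<in> \<S>" for T
      unfolding M_def using that bdd by (rule cSUP_upper)
    have smaller: "F T = 0" if "finite T" "card T < r" for T
      using less that by (simp add: r_def)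
    have "M \<le> 0"
    proof (rule ccontr)
      assume "\<not> M \<le> 0"
      then have M: "M > 0" by simp
      have bound: "\<bar>F T\<bar> \<le> M" if "finite T" "card T \<le> r" for T
        using le_M[of T] smaller[of T] that M F(3)
        by (cases "T = {}"; cases "card T = r") (auto simp: \<S>_def)
      obtain d :: nat where d: "\<And>u n0 n. \<lbrakk>\<And>m. \<bar>u m\<bar> \<le> 1; \<And>m. m > n0 \<Longrightarrow> harmonic_at u m; n \<ge> n0 + int d\<rbrakk> \<Longrightarrow> \<bar>u n\<bar> \<le> M / 2"
        using harmonic_decay[OF canc, of "M / 2"] M by auto
      have "\<forall>g. \<exists>\<epsilon>>0. \<forall>T. finite T \<longrightarrow> card T = r \<longrightarrow> T \<noteq> {} \<longrightarrow> Max T - int (Suc g) \<in> T \<longrightarrow> \<bar>F T\<bar> \<le> M - \<epsilon>"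
        using gap_bound[OF F(1) bound smaller gcd M] by blast
      then obtain \<epsilon> where \<epsilon>: "\<And>g. \<epsilon> g > 0"
        "\<And>g T. T \<in> \<S> \<Longrightarrow> Max T - int (Suc g) \<in> T \<Longrightarrow> \<bar>F T\<bar> \<le> M - \<epsilon> g"
        unfolding \<S>_def mem_Collect_eq by metis
      \<comment> \<open>The finitely many gaps \<open>Suc g\<close> with \<open>g \<le> d\<close>
        lose \<open>\<epsilon> g\<close>, and larger gaps lose half of \<open>M\<close> by decay.
        Hence one positive loss serves all sets of size \<open>r\<close>, contradicting that
        \<open>M\<close> is their supremum.\<close>
      define \<eta> where "\<eta> = Min (insert (M / 2) (\<epsilon> ` {..d}))"
      have \<eta>: "\<eta> > 0" "\<eta> \<le> M / 2" "\<And>g. g \<le> d \<Longrightarrow> \<eta> \<le> \<epsilon> g"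
        using \<epsilon>(1) M by (auto simp: \<eta>_def intro!: min.coboundedI2)
      have "\<bar>F T\<bar> \<le> M - \<eta>" if T: "T \<in> \<S>" for T
      proof (cases "\<exists>g\<le>d. Max T - int (Suc g) \<in> T")
        case True
        then obtain g where g: "g \<le> d" "Max T - int (Suc g) \<in> T" by blast
        from \<epsilon>(2)[OF T g(2)] \<eta>(3)[OF g(1)] show ?thesis by linarith
      next
        case False
        define n where "n = Max T"
        define T' where "T' = T - {n}"
        have n: "n \<in> T" using T unfolding n_def \<S>_def by (intro Max_in) auto
        then have T': "finite T'" "insert n T' = T" "n \<notin> T'"
          using T by (auto simp: T'_def \<S>_def)
        have "x \<le> n - int d" if "x \<in> T'" for x
        proof (rule ccontr)
          assume x: "\<not> x \<le> n - int d"
          have "x \<le> n" "x \<noteq> n" using that T by (auto simp: T'_def n_def \<S>_def)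
          then have "n - int (Suc (nat (n - x - 1))) = x" by simp
          moreover have "nat (n - x - 1) \<le> d" using x by simp
          moreover have "x \<in> T" using that by (simp add: T'_def)
          ultimately show False using False unfolding n_def by metis
        qed
        \<comment> \<open>All other elements lie at or below \<open>n - int d\<close>, so the
          one-point equation holds beyond that site, and the decay over distance \<open>d\<close>
          applies at \<open>n\<close>.\<close>
        then have "\<bar>F (toggle n T')\<bar> \<le> M / 2"
          by (intro d[where ?n0.0="n - int d"] recursive_harmonic F) (use T' F in force)+
        then show ?thesis using T' \<eta>(2) by (simp add: toggle_def)
      qed
      then have "M \<le> M - \<eta>"
        unfolding M_def using S by (intro cSUP_least) auto
      with \<eta> show False by simp
    qed
    then show ?thesis using le_M[OF S] by simp
  qed (simp add: F)
qed

end

section \<open>Laws and moments\<close>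

lemma space_pathspace [simp]: "space pathspace = UNIV"
  by (simp add: pathspace_def space_PiM)

lemma measurable_coordinate [measurable]: "(\<lambda>x. x i) \<in> measurable pathspace (count_space UNIV)"
  unfolding pathspace_def by measurable

lemma measurable_pathspaceI:
  assumes "\<And>i. (\<lambda>\<omega>. f \<omega> i) \<in> measurable M (count_space UNIV)"
  shows "f \<in> measurable M pathspace"
  unfolding pathspace_def using assms by (intro measurable_PiM_single') auto

definition law :: "(int \<Rightarrow> bool) measure \<Rightarrow> bool" where
  "law M \<longleftrightarrow> prob_space M \<and> sets M = sets pathspace"

lemma law_prob_space: "law M \<Longrightarrow> prob_space M"
  by (simp add: law_def)

lemma law_sets: "law M \<Longrightarrow> sets M = sets pathspace"
  by (simp add: law_def)

lemma law_space: "law M \<Longrightarrow> space M = UNIV"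
  using sets_eq_imp_space_eq[of M pathspace] by (simp add: law_def)

lemma law_measurable_cong: "law M \<Longrightarrow> measurable M N = measurable pathspace N"
  by (intro measurable_cong_sets law_sets) auto

lemma law_distr: "prob_space M \<Longrightarrow> f \<in> measurable M pathspace \<Longrightarrow> law (distr M pathspace f)"
  by (simp add: law_def prob_space.prob_space_distr)

lemma law_integrable:
  assumes "law M" "f \<in> borel_measurable pathspace" "\<And>x. \<bar>f x\<bar> \<le> (B::real)"
  shows "integrable M f"
proof -
  interpret prob_space M using assms(1) by (rule law_prob_space)
  show ?thesis
    using assms by (intro integrable_const_bound[where B=B]) (auto simp: law_measurable_cong)
qed

text \<open>These are the Walsh functions on the path space, so \<open>moment\<close> gives the
  Fourier coefficients of a law.\<close>

definition chi :: "int set \<Rightarrow> (int \<Rightarrow> bool) \<Rightarrow> real" where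
  "chi S x = (\<Prod>i\<in>S. spin (x i))"

definition moment :: "(int \<Rightarrow> bool) measure \<Rightarrow> int set \<Rightarrow> real" where
  "moment M S = (\<integral>x. chi S x \<partial>M)"

lemma measurable_chi [measurable]: "chi S \<in> borel_measurable pathspace"
  unfolding chi_def by measurable

lemma abs_chi [simp]: "\<bar>chi S x\<bar> = 1"
  by (simp add: chi_def abs_prod)

lemma chi_empty [simp]: "chi {} x = 1"
  by (simp add: chi_def)

lemma chi_insert: "finite S \<Longrightarrow> i \<notin> S \<Longrightarrow> chi (insert i S) x = spin (x i) * chi S x"
  by (simp add: chi_def)

lemma spin_square [simp]: "spin b * spin b = 1"
  by (simp add: spin_def)

lemma chi_toggle:
  assumes "finite S"
  shows "chi (toggle i S) x = spin (x i) * chi S x"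
proof (cases "i \<in> S")
  case True
  then have "chi S x = spin (x i) * chi (S - {i}) x"
    using chi_insert[of "S - {i}" i x] assms by (simp add: insert_absorb)
  then show ?thesis using True by (simp add: toggle_def flip: mult.assoc)
qed (use assms in \<open>simp add: toggle_def chi_insert\<close>)

lemma chi_cong: "(\<And>i. i \<in> S \<Longrightarrow> x i = y i) \<Longrightarrow> chi S x = chi S y"
  by (simp add: chi_def)

lemma moment_empty: "law M \<Longrightarrow> moment M {} = 1"
  using prob_space.prob_space[of M] by (simp add: moment_def law_def)

lemma integrable_chi: "law M \<Longrightarrow> integrable M (chi S)"
  by (rule law_integrable[where B=1]) auto

lemma abs_moment_le: "law M \<Longrightarrow> \<bar>moment M S\<bar> \<le> 1"
proof -
  assume M: "law M"
  interpret prob_space M using M by (rule law_prob_space)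
  have "\<bar>moment M S\<bar> \<le> (\<integral>x. \<bar>chi S x\<bar> \<partial>M)"
    unfolding moment_def by (rule integral_abs_bound)
  then show ?thesis by (simp add: prob_space)
qed

text \<open>A one-coordinate indicator is an affine function of the spin, so the indicator of a
  finite cylinder is a linear combination of Walsh functions, and cylinders determine the
  law.\<close>

lemma law_eqI:
  assumes M: "law M" and N: "law N"
    and eq: "\<And>S. finite S \<Longrightarrow> moment M S = moment N S"
  shows "M = N"
proof -
  \<comment> \<open>The factor \<open>chi S\<close> makes the induction close: expanding the
    indicator at one site gives functions of the same kind, with \<open>S\<close> kept or
    toggled.\<close>
  define h where "h J A S x = (\<Prod>i\<in>J. of_bool (x i \<in> A i)) * chi S x" for J A S x
  have h_meas [measurable]: "h J A S \<in> borel_measurable pathspace" for J A S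
    unfolding h_def by measurable
  have h_bound: "\<bar>h J A S x\<bar> \<le> 1" for J A S x
    by (auto simp: h_def abs_mult abs_prod intro!: prod_le_1)
  have int: "integrable M (h J A S)" "integrable N (h J A S)" for J A S
    using h_bound by (auto intro!: law_integrable M N)
  have *: "(\<integral>x. h J A S x \<partial>M) = (\<integral>x. h J A S x \<partial>N)" if "finite J" "finite S" for J A S
    using that
  proof (induction J arbitrary: S rule: finite_induct)
    case empty
    then show ?case using eq by (simp add: h_def moment_def)
  next
    case (insert j J)
    define \<alpha> \<beta> :: real where "\<alpha> = (of_bool (True \<in> A j) + of_bool (False \<in> A j)) / 2"
      and "\<beta> = (of_bool (True \<in> A j) - of_bool (False \<in> A j)) / 2"
    have "of_bool (b \<in> A j) = \<alpha> + \<beta> * spin b" for b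
      by (cases b) (auto simp: \<alpha>_def \<beta>_def spin_def field_simps)
    then have "h (insert j J) A S x = \<alpha> * h J A S x + \<beta> * h J A (toggle j S) x" for x
      using insert by (simp add: h_def chi_toggle algebra_simps)
    then show ?case
      using insert by (simp add: int)
  qed
  show ?thesis
  proof (rule measure_eqI_PiM_infinite)
    show "sets M = sets (PiM UNIV (\<lambda>_. count_space UNIV))" "sets N = sets (PiM UNIV (\<lambda>_. count_space UNIV))"
      using M N by (auto simp: law_def pathspace_def)
    show "finite_measure M"
      using M by (simp add: law_def prob_space.finite_measure)
    fix A :: "int \<Rightarrow> bool set" and J :: "int set"
    assume J: "finite J"
    define C where "C = {x :: int \<Rightarrow> bool. \<forall>i\<in>J. x i \<in> A i}"
    have C: "prod_emb UNIV (\<lambda>_. count_space UNIV) J (Pi\<^sub>E J A) = C"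
      by (auto simp: C_def prod_emb_def space_PiM PiE_iff)
    have "C \<in> sets pathspace"
      unfolding pathspace_def C[symmetric] using J by (intro sets_PiM_I) auto
    then have CM: "C \<in> sets M" "C \<in> sets N" using M N by (auto simp: law_sets)
    have h: "h J A {} x = indicator C x" for x
      using J by (auto simp: h_def C_def indicator_def prod_zero_iff)
    have "measure M C = measure N C"
      using *[of J "{}" A] J CM unfolding h by simp
    moreover interpret M: prob_space M using M by (rule law_prob_space)
    interpret N: prob_space N using N by (rule law_prob_space)
    show "emeasure M (prod_emb UNIV (\<lambda>_. count_space UNIV) J (Pi\<^sub>E J A))
        = emeasure N (prod_emb UNIV (\<lambda>_. count_space UNIV) J (Pi\<^sub>E J A))"
      unfolding C M.emeasure_eq_measure N.emeasure_eq_measure using calculation by simp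
  qed
qed

section \<open>The sigma-algebra of the past\<close>

lemma past_generator_sub: "{{x \<in> space pathspace. x m = b} | m b. m < n} \<subseteq> Pow (space pathspace)"
  by auto

lemma sets_past: "sets (past n) = sigma_sets UNIV {{x. x m = b} | m b. m < n}"
  using past_generator_sub[of n] by (simp add: past_def sets_measure_of)

lemma space_past [simp]: "space (past n) = UNIV"
  using past_generator_sub[of n] by (simp add: past_def space_measure_of)

lemma subalgebra_past: "law M \<Longrightarrow> subalgebra M (past n)"
proof -
  assume M: "law M"
  have "{x. x m = b} \<in> sets M" for m :: int and b
  proof -
    have "(\<lambda>x. x m) -` {b} \<inter> space pathspace \<in> sets pathspace"
      by (rule measurable_sets[OF measurable_coordinate]) auto
    then show ?thesis using M by (simp add: law_sets vimage_def)
  qed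
  then have "sigma_sets (space M) {{x. x m = b} | m b. m < n} \<subseteq> sets M"
    by (intro sets.sigma_sets_subset) auto
  then show ?thesis
    using M by (simp add: subalgebra_def sets_past law_space)
qed

lemma measurable_coordinate_past: "m < n \<Longrightarrow> (\<lambda>x. x m) \<in> measurable (past n) (count_space UNIV)"
proof (rule measurableI)
  fix B :: "bool set" assume "m < n"
  have "{x. x m \<in> B} \<in> sets (past n)"
  proof -
    have "{x. x m = b} \<in> sets (past n)" for b
      using \<open>m < n\<close> by (auto simp: sets_past)
    then have "(\<Union>b\<in>B. {x. x m = b}) \<in> sets (past n)"
      by (intro sets.finite_UN) auto
    also have "(\<Union>b\<in>B. {x. x m = b}) = {x. x m \<in> B}"
      by auto
    finally show ?thesis .
  qed
  then show "(\<lambda>x. x m) -` B \<inter> space (past n) \<in> sets (past n)"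
    by (simp add: vimage_def)
qed auto

lemma past_cong:
  assumes "A \<in> sets (past n)" "\<And>i. i < n \<Longrightarrow> x i = y i"
  shows "x \<in> A \<longleftrightarrow> y \<in> A"
  using assms(1) unfolding sets_past
  by (induction rule: sigma_sets.induct) (use assms(2) in auto)

section \<open>Compatibility as a recursion for moments\<close>

context spin_mixture
begin

text \<open>The mixture kernel in lag form: after drawing \<open>k\<close>, the new state is
  \<open>w k = s k\<close>, which copies \<open>w k\<close> or flips it.\<close>

definition kernel :: "bool \<Rightarrow> (nat \<Rightarrow> bool) \<Rightarrow> real" where
  "kernel g w = E (\<lambda>k. of_bool ((w k = s k) = g))"

lemma measurable_kernel_past:
  "(\<lambda>x. kernel g (\<lambda>k. x (n - int k))) \<in> borel_measurable (past n)"
proof -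
  \<comment> \<open>Lag 0 would read the site \<open>n\<close>, which is not in the past. It has
    probability 0, so setting its term to 0 secures measurability without changing the
    expectation.\<close>
  define f where "f k x = (if k = 0 then 0 else of_bool ((x (n - int k) = s k) = g) :: real)"
    for k and x :: "int \<Rightarrow> bool"
  have f: "f k \<in> borel_measurable (past n)" for k
  proof (cases "k = 0")
    case False
    then have [measurable]: "(\<lambda>x. x (n - int k)) \<in> measurable (past n) (count_space UNIV)"
      by (intro measurable_coordinate_past) auto
    show ?thesis unfolding f_def by measurable
  qed (simp add: f_def [abs_def])
  have [measurable]: "(\<lambda>(x, k). f k x) \<in> borel_measurable (past n \<Otimes>\<^sub>M measure_pmf \<kappa>)"
  proof -
    have "(\<lambda>\<omega>. f (snd \<omega>) (fst \<omega>)) \<in> borel_measurable (past n \<Otimes>\<^sub>M measure_pmf \<kappa>)"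
      by (rule measurable_compose_countable[where f="\<lambda>k \<omega>. f k (fst \<omega>)"])
         (auto intro: measurable_compose[OF measurable_fst f] measurable_compose[OF measurable_snd])
    then show ?thesis by (simp add: case_prod_unfold)
  qed
  have "(\<lambda>x. E (\<lambda>k. f k x)) \<in> borel_measurable (past n)"
    by (rule measure_pmf.borel_measurable_lebesgue_integral) measurable
  moreover have "E (\<lambda>k. f k x) = kernel g (\<lambda>k. x (n - int k))" for x
    unfolding kernel_def f_def using zero_notin
    by (intro integral_cong_AE) (auto simp: AE_measure_pmf_iff)
  ultimately show ?thesis by simp
qed

lemma kernel_bounds: "0 \<le> kernel g w" "kernel g w \<le> 1"
proof -
  show "0 \<le> kernel g w" by (simp add: kernel_def)
  have "kernel g w \<le> E (\<lambda>_. 1)"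
    unfolding kernel_def by (intro integral_mono integrable_bounded[where B=1]) auto
  then show "kernel g w \<le> 1" by simp
qed

definition update :: "int \<Rightarrow> (int \<Rightarrow> bool) \<Rightarrow> nat \<Rightarrow> int \<Rightarrow> bool" where
  "update n x k = x(n := (x (n - int k) = s k))"

text \<open>The state at \<open>n\<close> is drawn afresh given the old path, and every other site
  keeps its state, also those after \<open>n\<close>. Compatibility at \<open>n\<close> amounts to
  the path up to \<open>n\<close> having the same law under \<open>M\<close> and
  \<open>resample n M\<close>.\<close>

definition resample :: "int \<Rightarrow> (int \<Rightarrow> bool) measure \<Rightarrow> (int \<Rightarrow> bool) measure" where
  "resample n M = distr (M \<Otimes>\<^sub>M measure_pmf \<kappa>) pathspace (\<lambda>(x, k). update n x k)"

lemma measurable_update: 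
  assumes "law M"
  shows "(\<lambda>(x, k). update n x k) \<in> measurable (M \<Otimes>\<^sub>M measure_pmf \<kappa>) pathspace"
proof (rule measurable_pathspaceI)
  fix i
  have c [measurable]: "(\<lambda>\<omega>. fst \<omega> j) \<in> measurable (M \<Otimes>\<^sub>M measure_pmf \<kappa>) (count_space UNIV)" for j
    using assms by (intro measurable_compose[OF measurable_fst]) (simp add: law_measurable_cong)
  have "(\<lambda>\<omega>. fst \<omega> (n - int (snd \<omega>)) = s (snd \<omega>)) \<in> measurable (M \<Otimes>\<^sub>M measure_pmf \<kappa>) (count_space UNIV)"
  proof (rule measurable_compose_countable[where f="\<lambda>k \<omega>. fst \<omega> (n - int k) = s k"])
    show "(\<lambda>\<omega>. fst \<omega> (n - int k) = s k) \<in> measurable (M \<Otimes>\<^sub>M measure_pmf \<kappa>) (count_space UNIV)" for k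
      by (rule measurable_compose[OF c]) simp
    show "snd \<in> measurable (M \<Otimes>\<^sub>M measure_pmf \<kappa>) (count_space UNIV)"
      using measurable_snd[of M "measure_pmf \<kappa>"] by (simp cong: measurable_cong_sets)
  qed
  then show "(\<lambda>\<omega>. (case \<omega> of (x, k) \<Rightarrow> update n x k) i) \<in> measurable (M \<Otimes>\<^sub>M measure_pmf \<kappa>) (count_space UNIV)"
    by (cases "i = n") (simp_all add: update_def case_prod_unfold)
qed

lemma law_resample: "law M \<Longrightarrow> law (resample n M)"
proof -
  assume M: "law M"
  interpret prob_space M using M by (rule law_prob_space)
  interpret P: pair_prob_space M "measure_pmf \<kappa>" ..
  show ?thesis
    unfolding resample_def using M by (intro law_distr measurable_update P.prob_space_axioms)
qed

lemma integral_resample: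
  assumes M: "law M" and f: "f \<in> borel_measurable pathspace" and bound: "\<And>x. \<bar>f x\<bar> \<le> (B::real)"
  shows "(\<integral>x. f x \<partial>resample n M) = (\<integral>x. E (\<lambda>k. f (update n x k)) \<partial>M)"
    and "(\<integral>x. f x \<partial>resample n M) = E (\<lambda>k. \<integral>x. f (update n x k) \<partial>M)"
proof -
  interpret prob_space M using M by (rule law_prob_space)
  interpret P: pair_prob_space M "measure_pmf \<kappa>" ..
  have meas: "(\<lambda>(x, k). f (update n x k)) \<in> borel_measurable (M \<Otimes>\<^sub>M measure_pmf \<kappa>)"
    using measurable_compose[OF measurable_update[OF M, of n] f] by (simp add: case_prod_unfold)
  have int: "integrable (M \<Otimes>\<^sub>M measure_pmf \<kappa>) (\<lambda>(x, k). f (update n x k))"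
    using bound by (intro P.integrable_const_bound[where B=B] meas) auto
  have "(\<integral>x. f x \<partial>resample n M) = (\<integral>\<omega>. (case \<omega> of (x, k) \<Rightarrow> f (update n x k)) \<partial>(M \<Otimes>\<^sub>M measure_pmf \<kappa>))"
    unfolding resample_def using f measurable_update[OF M, of n]
    by (simp add: integral_distr case_prod_unfold)
  then show "(\<integral>x. f x \<partial>resample n M) = (\<integral>x. E (\<lambda>k. f (update n x k)) \<partial>M)"
    and "(\<integral>x. f x \<partial>resample n M) = E (\<lambda>k. \<integral>x. f (update n x k) \<partial>M)"
    using P.integral_fst'[OF int] P.integral_snd[OF int] by simp_all
qed

text \<open>The new spin at \<open>n\<close> is \<open>e k\<close> times the old spin at
  \<open>n - int k\<close>, so drawing the lag \<open>k\<close> trades the element \<open>n\<close>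
  for a toggle at \<open>n - int k\<close>.\<close>

lemma moment_resample:
  assumes "law M" "finite S"
  shows "moment (resample n M) S =
    (if n \<in> S then E (\<lambda>k. e k * moment M (toggle (n - int k) (S - {n}))) else moment M S)"
proof (cases "n \<in> S")
  case True
  have "chi S (update n x k) = e k * chi (toggle (n - int k) (S - {n})) x" for x k
  proof -
    have "chi S (update n x k) = spin (update n x k n) * chi (S - {n}) (update n x k)"
      using chi_insert[of "S - {n}" n "update n x k"] True assms(2) by (simp add: insert_absorb)
    also have "chi (S - {n}) (update n x k) = chi (S - {n}) x"
      by (rule chi_cong) (simp add: update_def)
    finally show ?thesis
      using assms(2) by (simp add: chi_toggle spin_eq_iff update_def mult_ac del: fun_upd_apply)
         (simp add: spin_eq_iff)
  qed
  then show ?thesis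
    using True integral_resample(2)[OF assms(1) measurable_chi[of S], of 1 n] by (simp add: moment_def)
next
  case False
  then have "chi S (update n x k) = chi S x" for x k
    by (intro chi_cong) (auto simp: update_def)
  then show ?thesis
    using False integral_resample(2)[OF assms(1) measurable_chi[of S], of 1 n] by (simp add: moment_def)
qed

lemma recursive_moment_iff:
  assumes "law M"
  shows "recursive (moment M) n \<longleftrightarrow>
    (\<forall>S. finite S \<longrightarrow> S \<subseteq> {..<n} \<longrightarrow> moment M (insert n S) = moment (resample n M) (insert n S))"
proof -
  have "moment (resample n M) (insert n S) = E (\<lambda>k. e k * moment M (toggle (n - int k) S))"
    if "finite S" "S \<subseteq> {..<n}" for S
  proof -
    have "insert n S - {n} = S" using that by auto
    then show ?thesis using moment_resample[OF assms, of "insert n S" n] that by simp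
  qed
  then show ?thesis by (auto simp: recursive_def)
qed

lemma integral_resample_past:
  assumes M: "law M" and f: "f \<in> borel_measurable pathspace" "\<And>x. \<bar>f x\<bar> \<le> (B::real)"
    and inv: "\<And>x b. f (x(n := b)) = f x"
  shows "(\<integral>x. f x * of_bool (x n = g) \<partial>resample n M) = (\<integral>x. f x * kernel g (\<lambda>k. x (n - int k)) \<partial>M)"
proof -
  have [measurable]: "(\<lambda>x. f x * of_bool (x n = g)) \<in> borel_measurable pathspace"
    using f(1) by measurable
  have "\<bar>f x * of_bool (x n = g)\<bar> \<le> B" for x
    using f(2)[of x] by (auto simp: of_bool_def)
  then have "(\<integral>x. f x * of_bool (x n = g) \<partial>resample n M)
      = (\<integral>x. E (\<lambda>k. f (update n x k) * of_bool (update n x k n = g)) \<partial>M)"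
    using M by (intro integral_resample(1)[where B=B]) auto
  also have "\<dots> = (\<integral>x. f x * kernel g (\<lambda>k. x (n - int k)) \<partial>M)"
    by (simp add: update_def inv kernel_def)
  finally show ?thesis .
qed

lemma moment_insert_eq:
  assumes "law M" "finite S" "S \<subseteq> {..<n}"
  shows "moment M (insert n S) = 2 * (\<integral>x. chi S x * of_bool (x n = True) \<partial>M) - moment M S"
proof -
  have "n \<notin> S" using assms(3) by auto
  then have "chi (insert n S) x = 2 * (chi S x * of_bool (x n = True)) - chi S x" for x
    using assms(2) by (cases "x n") (simp_all add: chi_insert spin_def)
  moreover have "integrable M (\<lambda>x. chi S x * of_bool (x n = True))"
    using assms(1) by (intro law_integrable[where B=1]) (auto simp: abs_mult)
  ultimately show ?thesis
    using integrable_chi[OF assms(1), of S] by (simp add: moment_def)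
qed

text \<open>The conditional expectation is tested against \<open>chi S\<close>, which is measurable
  in the past because \<open>S\<close> lies left of \<open>n\<close>;
  \<open>moment_insert_eq\<close> turns the resulting identity into one of moments.\<close>

lemma recursive_momentI:
  assumes M: "law M"
    and ce: "AE x in M. real_cond_exp M (past n) (indicator {y. y n = True}) x = kernel True (\<lambda>k. x (n - int k))"
  shows "recursive (moment M) n"
  unfolding recursive_moment_iff[OF M]
proof (intro allI impI)
  fix S assume S: "finite S" "S \<subseteq> {..<n}"
  interpret prob_space M using M by (rule law_prob_space)
  interpret finite_measure_subalgebra M "past n"
    using subalgebra_past[OF M] by unfold_locales
  have chi_past: "chi S \<in> borel_measurable (past n)"
    unfolding chi_def
    using S by (intro borel_measurable_prod measurable_compose[OF measurable_coordinate_past]) auto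
  have [measurable]: "chi S \<in> borel_measurable M" "(indicator {y. y n = True} :: _ \<Rightarrow> real) \<in> borel_measurable M"
    unfolding law_measurable_cong[OF M] by measurable
  have ker: "(\<lambda>x. kernel True (\<lambda>k. x (n - int k))) \<in> borel_measurable M"
    using measurable_from_subalg[OF subalg measurable_kernel_past] .
  have int: "integrable M (\<lambda>x. chi S x * indicator {y. y n = True} x)"
    using M by (intro law_integrable[where B=1]) (auto simp: abs_mult indicator_def)
  have "(\<integral>x. chi S x * of_bool (x n = True) \<partial>M) = (\<integral>x. chi S x * indicator {y. y n = True} x \<partial>M)"
    by (intro Bochner_Integration.integral_cong) (auto simp: indicator_def)
  also have "\<dots> = (\<integral>x. chi S x * real_cond_exp M (past n) (indicator {y. y n = True}) x \<partial>M)"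
    by (rule real_cond_exp_intg(2)[OF int chi_past, symmetric]) measurable
  also have "\<dots> = (\<integral>x. chi S x * kernel True (\<lambda>k. x (n - int k)) \<partial>M)"
    using ce ker by (intro integral_cong_AE) auto
  also have "\<dots> = (\<integral>x. chi S x * of_bool (x n = True) \<partial>resample n M)"
  proof (rule integral_resample_past[symmetric, OF M])
    show "chi S (x(n := b)) = chi S x" for x b
      using S by (intro chi_cong) auto
  qed auto
  finally have "(\<integral>x. chi S x * of_bool (x n = True) \<partial>M) = (\<integral>x. chi S x * of_bool (x n = True) \<partial>resample n M)" .
  moreover have "n \<notin> S" using S by auto
  ultimately show "moment M (insert n S) = moment (resample n M) (insert n S)"
    using S moment_resample[OF M S(1), of n]
    by (simp add: moment_insert_eq M law_resample)
qed

text \<open>The recursion says that resampling at \<open>n\<close> preserves every moment over sites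
  up to \<open>n\<close>, and these moments determine the law of the path up to
  \<open>n\<close>.\<close>

lemma recursive_moment_imp_past_agree:
  assumes M: "law M" and rec: "recursive (moment M) n"
    and A: "A \<in> sets pathspace" "\<And>x y. (\<And>i. i \<le> n \<Longrightarrow> x i = y i) \<Longrightarrow> x \<in> A \<longleftrightarrow> y \<in> A"
  shows "measure M A = measure (resample n M) A"
proof -
  \<comment> \<open>Freezing the later sites at \<open>True\<close>, with spin 1, removes them from
    every moment, so \<open>law_eqI\<close> applies to the laws pushed forward by
    \<open>r\<close>.\<close>
  define r where "r x i = (if i \<le> n then x i else True)" for x :: "int \<Rightarrow> bool" and i
  have r [measurable]: "r \<in> measurable pathspace pathspace"
    unfolding r_def by (rule measurable_pathspaceI) measurable
  have r': "r \<in> measurable N pathspace" if "law N" for N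
    using that by (simp add: law_measurable_cong)
  have law_r: "law (distr N pathspace r)" if "law N" for N
    using that r' by (intro law_distr law_prob_space)
  have mom: "moment (distr N pathspace r) S = moment N (S \<inter> {..n})" if "law N" "finite S" for N S
  proof -
    have "chi S (r x) = chi (S \<inter> {..n}) x" for x
    proof -
      have "chi S (r x) = (\<Prod>i\<in>S \<inter> {..n}. spin (r x i))"
        unfolding chi_def using that(2) by (intro prod.mono_neutral_right) (auto simp: r_def spin_def)
      then show ?thesis by (simp add: chi_def r_def)
    qed
    then show ?thesis
      using r'[OF that(1)] by (simp add: moment_def integral_distr)
  qed
  have eq: "distr M pathspace r = distr (resample n M) pathspace r"
  proof (intro law_eqI law_r M law_resample)
    fix S :: "int set" assume S: "finite S"
    have "moment M (S \<inter> {..n}) = moment (resample n M) (S \<inter> {..n})"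
    proof (cases "n \<in> S")
      case True
      then have "S \<inter> {..n} = insert n (S \<inter> {..<n})" by auto
      then show ?thesis
        using rec S unfolding recursive_moment_iff[OF M] by simp
    next
      case False
      then show ?thesis using moment_resample[OF M, of "S \<inter> {..n}" n] S by simp
    qed
    then show "moment (distr M pathspace r) S = moment (distr (resample n M) pathspace r) S"
      using S M law_resample by (simp add: mom)
  qed
  have ms: "measure (distr N pathspace r) A = measure N A" if "law N" for N
  proof -
    have "r x \<in> A \<longleftrightarrow> x \<in> A" for x by (rule A(2)) (simp add: r_def)
    then have "r -` A = A" by auto
    then show ?thesis using that r' A(1) by (simp add: measure_distr law_space)
  qed
  show ?thesis using ms[OF M] ms[OF law_resample[OF M, of n]] unfolding eq by simp
qed

text \<open>For \<open>A\<close> in the past, the probability of \<open>A\<close> with state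
  \<open>g\<close> at \<open>n\<close> may be computed under the resampled law, where the state at
  \<open>n\<close> is drawn from the kernel and \<open>A\<close> is unaffected.\<close>

lemma real_cond_exp_eq_kernel:
  assumes M: "law M" and rec: "recursive (moment M) n"
  shows "AE x in M. real_cond_exp M (past n) (indicator {y. y n = g}) x = kernel g (\<lambda>k. x (n - int k))"
proof -
  interpret prob_space M using M by (rule law_prob_space)
  interpret finite_measure_subalgebra M "past n"
    using subalgebra_past[OF M] by unfold_locales
  have ker: "(\<lambda>x. kernel g (\<lambda>k. x (n - int k))) \<in> borel_measurable pathspace"
    using measurable_from_subalg[OF subalg measurable_kernel_past] unfolding law_measurable_cong[OF M] .
  have ind: "(indicator {y. y n = g} :: _ \<Rightarrow> real) \<in> borel_measurable pathspace"
    by measurable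
  show ?thesis
  proof (rule real_cond_exp_charact)
    show "integrable M (indicator {y. y n = g} :: _ \<Rightarrow> real)"
      using M ind by (intro law_integrable[where B=1]) (auto simp: indicator_def)
    show "integrable M (\<lambda>x. kernel g (\<lambda>k. x (n - int k)))"
      using M ker kernel_bounds by (intro law_integrable[where B=1]) auto
    show "(\<lambda>x. kernel g (\<lambda>k. x (n - int k))) \<in> borel_measurable (past n)"
      by (rule measurable_kernel_past)
    fix A assume A: "A \<in> sets (past n)"
    then have A': "A \<in> sets pathspace"
      using subalg M by (auto simp: subalgebra_def law_sets)
    have G: "{y. y n = g} \<in> sets pathspace"
      using ind by (simp add: borel_measurable_indicator_iff)
    have "(\<integral>x\<in>A. indicator {y. y n = g} x \<partial>M) = measure M (A \<inter> {y. y n = g})"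
      using A' G M by (simp add: set_lebesgue_integral_def law_sets flip: indicator_inter_arith)
    also have "\<dots> = measure (resample n M) (A \<inter> {y. y n = g})"
    proof (rule recursive_moment_imp_past_agree[OF M rec])
      show "A \<inter> {y. y n = g} \<in> sets pathspace" using A' G by blast
      show "x \<in> A \<inter> {y. y n = g} \<longleftrightarrow> y \<in> A \<inter> {y. y n = g}" if "\<And>i. i \<le> n \<Longrightarrow> x i = y i" for x y
        using past_cong[OF A, of x y] that by auto
    qed
    also have "\<dots> = (\<integral>x. indicator A x * of_bool (x n = g) \<partial>resample n M)"
    proof -
      have "(\<integral>x. indicator A x * of_bool (x n = g) \<partial>resample n M) = (\<integral>x. (indicator :: _ \<Rightarrow> _ \<Rightarrow> real) (A \<inter> {y. y n = g}) x \<partial>resample n M)"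
        by (intro Bochner_Integration.integral_cong) (auto simp: indicator_def)
      then show ?thesis using A' G law_resample[OF M, of n] by (simp add: law_sets)
    qed
    also have "\<dots> = (\<integral>x. indicator A x * kernel g (\<lambda>k. x (n - int k)) \<partial>M)"
    proof (rule integral_resample_past[OF M])
      show "indicator A (x(n := b)) = (indicator A x :: real)" for x b
        using past_cong[OF A, of "x(n := b)" x] by (auto simp: indicator_def)
    qed (use A' in \<open>auto simp: indicator_def\<close>)
    finally show "(\<integral>x\<in>A. indicator {y. y n = g} x \<partial>M) = (\<integral>x\<in>A. kernel g (\<lambda>k. x (n - int k)) \<partial>M)"
      by (simp add: set_lebesgue_integral_def)
  qed
qed

theorem compatible_kernel_iff:
  "compatible kernel M \<longleftrightarrow> law M \<and> (\<forall>n. recursive (moment M) n)"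
proof
  assume M: "compatible kernel M"
  then have law: "law M" by (simp add: compatible_def law_def)
  moreover have "recursive (moment M) n" for n
  proof (rule recursive_momentI[OF law])
    show "AE x in M. real_cond_exp M (past n) (indicator {y. y n = True}) x = kernel True (\<lambda>k. x (n - int k))"
      using M unfolding compatible_def by blast
  qed
  ultimately show "law M \<and> (\<forall>n. recursive (moment M) n)" by blast
next
  assume M: "law M \<and> (\<forall>n. recursive (moment M) n)"
  then show "compatible kernel M"
    unfolding compatible_def using real_cond_exp_eq_kernel law_def by blast
qed

end

section \<open>Existence and uniqueness\<close>

definition plus_sites :: "int set \<Rightarrow> (int \<Rightarrow> bool) \<Rightarrow> int set" where
  "plus_sites J x = {i \<in> J. x i}"

definition cyl :: "int set \<Rightarrow> int set \<Rightarrow> (int \<Rightarrow> bool) set" where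
  "cyl J W = {x. plus_sites J x = W}"

lemma sets_cyl: "finite J \<Longrightarrow> W \<subseteq> J \<Longrightarrow> cyl J W \<in> sets pathspace"
proof -
  assume J: "finite J" "W \<subseteq> J"
  have "{x \<in> space pathspace. \<forall>i\<in>J. x i = (i \<in> W)} \<in> sets pathspace"
    using J by measurable
  also have "{x \<in> space pathspace. \<forall>i\<in>J. x i = (i \<in> W)} = cyl J W"
    using J by (auto simp: cyl_def plus_sites_def)
  finally show ?thesis .
qed

lemma integral_trace:
  assumes M: "law M" and J: "finite J"
  shows "(\<integral>x. F (plus_sites J x) \<partial>M) = (\<Sum>W\<in>Pow J. measure M (cyl J W) * (F W :: real))"
proof -
  interpret prob_space M using M by (rule law_prob_space)
  have "F (plus_sites J x) = (\<Sum>W\<in>Pow J. indicator (cyl J W) x * F W)" for x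
  proof -
    have "(\<Sum>W\<in>Pow J. indicator (cyl J W) x * F W) = (\<Sum>W\<in>{plus_sites J x}. indicator (cyl J W) x * F W)"
      using J by (intro sum.mono_neutral_right) (auto simp: cyl_def indicator_def, auto simp: plus_sites_def)
    then show ?thesis by (simp add: cyl_def)
  qed
  then have "(\<integral>x. F (plus_sites J x) \<partial>M) = (\<integral>x. (\<Sum>W\<in>Pow J. indicator (cyl J W) x * F W) \<partial>M)"
    by presburger
  also have "\<dots> = (\<Sum>W\<in>Pow J. \<integral>x. indicator (cyl J W) x * F W \<partial>M)"
    using J M sets_cyl
    by (intro Bochner_Integration.integral_sum integrable_mult_left)
       (auto simp: law_sets emeasure_eq_measure)
  also have "\<dots> = (\<Sum>W\<in>Pow J. measure M (cyl J W) * F W)"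
    using M by (simp add: law_space)
  finally show ?thesis .
qed

definition spin_point :: "int set \<Rightarrow> int set \<Rightarrow> int \<Rightarrow> real" where
  "spin_point J W = (\<lambda>i\<in>J. spin (i \<in> W))"

text \<open>The weights become a measure on real-valued points over \<open>J\<close>, the form in
  which \<open>polish_projective\<close> extends a consistent family to all sites.\<close>

definition marginal :: "(int set \<Rightarrow> int set \<Rightarrow> real) \<Rightarrow> int set \<Rightarrow> (int \<Rightarrow> real) measure" where
  "marginal c J = distr (point_measure (Pow J) (\<lambda>W. ennreal (c J W))) (\<Pi>\<^sub>M i\<in>J. borel) (spin_point J)"

lemma measurable_spin_point:
  "spin_point J \<in> measurable (point_measure (Pow J) f) (\<Pi>\<^sub>M i\<in>J. borel)"
  by (auto simp: measurable_point_measure_eq1 spin_point_def space_PiM)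

lemma integral_marginal:
  assumes "finite J" "\<And>W. 0 \<le> c J W" "g \<in> borel_measurable (\<Pi>\<^sub>M i\<in>J. borel)"
  shows "(\<integral>y. g y \<partial>marginal c J) = (\<Sum>W\<in>Pow J. c J W * (g (spin_point J W) :: real))"
proof -
  have "(\<integral>y. g y \<partial>marginal c J) = (\<integral>W. g (spin_point J W) \<partial>point_measure (Pow J) (\<lambda>W. ennreal (c J W)))"
    unfolding marginal_def by (rule integral_distr[OF measurable_spin_point assms(3)])
  then show ?thesis
    using assms(1,2) by (simp add: lebesgue_integral_point_measure_finite)
qed

lemma prob_space_marginal:
  assumes "finite J" "\<And>W. 0 \<le> c J W" "(\<Sum>W\<in>Pow J. c J W) = 1"
  shows "prob_space (marginal c J)"
  unfolding marginal_def
proof (rule prob_space.prob_space_distr[OF _ measurable_spin_point])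
  have "(\<Sum>W\<in>Pow J. ennreal (c J W)) = 1"
    using assms by (simp add: sum_ennreal)
  then show "prob_space (point_measure (Pow J) (\<lambda>W. ennreal (c J W)))"
    using assms by (intro prob_spaceI) (simp add: space_point_measure emeasure_point_measure_finite)
qed

lemma measure_marginal:
  assumes "finite J" "\<And>W. 0 \<le> c J W" "A \<in> sets (\<Pi>\<^sub>M i\<in>J. borel)"
  shows "measure (marginal c J) A = (\<Sum>W\<in>Pow J. c J W * indicator A (spin_point J W))"
proof -
  have "(\<integral>y. indicator A y \<partial>marginal c J) = (\<Sum>W\<in>Pow J. c J W * (indicator A (spin_point J W) :: real))"
    using assms by (intro integral_marginal) auto
  moreover have "A \<inter> space (marginal c J) = A"
    using sets.sets_into_space[OF assms(3)] by (auto simp: marginal_def)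
  ultimately show ?thesis by simp
qed

text \<open>A diagonal argument makes the countably many cylinder probabilities converge. Their
  limits form consistent marginals, Kolmogorov extension gives the limit law, and each moment
  converges as a finite combination of cylinder probabilities.\<close>

lemma law_subsequence:
  assumes M: "\<And>m::nat. law (M m)"
  obtains r N where "strict_mono r" "law N"
    "\<And>S. finite S \<Longrightarrow> (\<lambda>m. moment (M (r m)) S) \<longlonglongrightarrow> moment N S"
proof -
  define f where "f m = (\<lambda>(J, W). measure (M m) (cyl J W))" for m
  have prob: "prob_space (M m)" for m using M by (rule law_prob_space)
  have "countable ({J :: int set. finite J} \<times> {J :: int set. finite J})"
    by (intro countable_SIGMA countable_Collect_finite)
  then obtain r where r: "strict_mono r"
    "\<And>J W. finite J \<Longrightarrow> finite W \<Longrightarrow> \<exists>l. (\<lambda>m. f (r m) (J, W)) \<longlonglongrightarrow> l"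
  proof (rule function_convergent_subsequence[where f=f and M=1])
    show "norm (f m x) \<le> 1" for m x
      using prob_space.prob_le_1[OF prob] by (cases x) (simp add: f_def)
  qed auto
  \<comment> \<open>The value 0 for infinite arguments makes \<open>c\<close> nonnegative
    everywhere, as the lemmas on \<open>marginal\<close> demand.\<close>
  define c where "c J W = (if finite J \<and> finite W then lim (\<lambda>m. f (r m) (J, W)) else 0)" for J W
  have c_lim: "(\<lambda>m. measure (M (r m)) (cyl J W)) \<longlonglongrightarrow> c J W" if "finite J" "finite W" for J W
    using r(2)[OF that] that by (auto simp: c_def f_def convergent_LIMSEQ_iff[symmetric] convergent_def)
  have c_nonneg: "0 \<le> c J W" for J W
  proof (cases "finite J \<and> finite W")
    case True
    then show ?thesis using c_lim[of J W] by (intro LIMSEQ_le_const) auto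
  qed (auto simp: c_def)
  have trace_lim: "(\<lambda>m. \<integral>x. F (plus_sites J x) \<partial>M (r m)) \<longlonglongrightarrow> (\<Sum>W\<in>Pow J. c J W * F W)"
    if J: "finite J" for F :: "int set \<Rightarrow> real" and J
    unfolding integral_trace[OF M J] using J
    by (intro tendsto_sum tendsto_mult c_lim tendsto_const) (auto intro: finite_subset)
  have c_sum: "(\<Sum>W\<in>Pow J. c J W) = 1" if "finite J" for J
    using LIMSEQ_unique[OF trace_lim[OF that, of "\<lambda>_. 1"], of 1] prob_space.prob_space[OF prob]
    by simp
  have prob_marginal: "prob_space (marginal c J)" if "finite J" for J
    using that c_nonneg c_sum by (intro prob_space_marginal) auto
  have "projective_family UNIV (marginal c) (\<lambda>_. borel)"
  proof (rule projective_family.intro)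
    fix J H :: "int set" assume JH: "J \<subseteq> H" "finite H"
    then have J: "finite J" by (rule finite_subset)
    interpret J: prob_space "marginal c J" using prob_marginal[OF J] .
    interpret H: prob_space "marginal c H" using prob_marginal[OF JH(2)] .
    have res: "(\<lambda>y. restrict y J) \<in> measurable (marginal c H) (\<Pi>\<^sub>M i\<in>J. borel)"
      using JH(1) by (simp add: marginal_def measurable_restrict_subset)
    interpret D: prob_space "distr (marginal c H) (\<Pi>\<^sub>M i\<in>J. borel) (\<lambda>y. restrict y J)"
      using res by (rule H.prob_space_distr)
    show "marginal c J = distr (marginal c H) (\<Pi>\<^sub>M i\<in>J. borel) (\<lambda>y. restrict y J)"
    proof (rule measure_eqI)
      fix A assume "A \<in> sets (marginal c J)"
      then have A: "A \<in> sets (\<Pi>\<^sub>M i\<in>J. borel :: real measure)" by (simp add: marginal_def)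
      \<comment> \<open>Consistency: both measures of \<open>A\<close> are limits of the same
        expectations, because the trace on \<open>J\<close> is determined by the trace on
        \<open>H\<close>.\<close>
      have "(\<lambda>m. \<integral>x. indicator A (spin_point J (plus_sites J x)) \<partial>M (r m)) \<longlonglongrightarrow> measure (marginal c J) A"
        using trace_lim[OF J, of "\<lambda>W. indicator A (spin_point J W)"] measure_marginal[OF J c_nonneg A] by simp
      moreover have "(\<lambda>m. \<integral>x. indicator A (spin_point J (plus_sites J x)) \<partial>M (r m))
          \<longlonglongrightarrow> measure (distr (marginal c H) (\<Pi>\<^sub>M i\<in>J. borel) (\<lambda>y. restrict y J)) A"
      proof -
        let ?A = "(\<lambda>y. restrict y J) -` A \<inter> space (marginal c H)"
        have A': "?A \<in> sets (\<Pi>\<^sub>M i\<in>H. borel)"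
          using measurable_sets[OF res A] by (simp add: marginal_def)
        have sp: "spin_point H W \<in> space (marginal c H)" "restrict (spin_point H W) J = spin_point J (J \<inter> W)" for W
          using JH(1) by (auto simp: marginal_def space_PiM spin_point_def restrict_def fun_eq_iff)
        have "J \<inter> plus_sites H x = plus_sites J x" for x
          using JH(1) by (auto simp: plus_sites_def)
        moreover have "indicator ?A (spin_point H W) = (indicator A (spin_point J (J \<inter> W)) :: real)" for W
          using sp[of W] by (auto simp: indicator_def)
        moreover have "measure (distr (marginal c H) (\<Pi>\<^sub>M i\<in>J. borel) (\<lambda>y. restrict y J)) A = measure (marginal c H) ?A"
          using res A by (rule measure_distr)
        ultimately show ?thesis
          using trace_lim[OF JH(2), of "\<lambda>W. indicator ?A (spin_point H W)"]
            measure_marginal[OF JH(2) c_nonneg A'] by simp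
      qed
      ultimately have "measure (marginal c J) A = measure (distr (marginal c H) (\<Pi>\<^sub>M i\<in>J. borel) (\<lambda>y. restrict y J)) A"
        by (rule LIMSEQ_unique)
      then show "emeasure (marginal c J) A = emeasure (distr (marginal c H) (\<Pi>\<^sub>M i\<in>J. borel) (\<lambda>y. restrict y J)) A"
        by (simp add: J.emeasure_eq_measure D.emeasure_eq_measure)
    qed (simp add: marginal_def)
  qed (rule prob_marginal)
  then interpret polish_projective UNIV "marginal c"
    by (rule polish_projective.intro)
  define to_path where "to_path y i = (y i > 0)" for y :: "int \<Rightarrow> real" and i
  have to_path: "to_path \<in> measurable lim pathspace"
    unfolding to_path_def measurable_cong_sets[OF sets_lim refl]
    by (rule measurable_pathspaceI) measurable
  define N where "N = distr lim pathspace to_path"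
  have "law N"
    unfolding N_def using to_path by (intro law_distr P.prob_space_axioms)
  moreover have "(\<lambda>m. moment (M (r m)) S) \<longlonglongrightarrow> moment N S" if S: "finite S" for S
  proof -
    have res: "(\<lambda>y. restrict y S) \<in> measurable lim (\<Pi>\<^sub>M i\<in>S. borel)"
      unfolding measurable_cong_sets[OF sets_lim refl] by (rule measurable_restrict_subset) auto
    have marg: "distr lim (\<Pi>\<^sub>M i\<in>S. borel) (\<lambda>y. restrict y S) = marginal c S"
    proof (rule measure_eqI)
      fix A assume "A \<in> sets (distr lim (\<Pi>\<^sub>M i\<in>S. borel) (\<lambda>y. restrict y S))"
      then have A: "A \<in> sets (\<Pi>\<^sub>M i\<in>S. borel :: real measure)" by simp
      then show "emeasure (distr lim (\<Pi>\<^sub>M i\<in>S. borel) (\<lambda>y. restrict y S)) A = emeasure (marginal c S) A"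
        using emeasure_lim_emb[OF subset_UNIV S A] emeasure_distr[OF res A]
        by (simp add: prod_emb_def space_PiM vimage_def)
    qed (simp add: marginal_def)
    let ?g = "\<lambda>y. chi S (\<lambda>i. y i > (0::real))"
    have g: "?g \<in> borel_measurable (\<Pi>\<^sub>M i\<in>S. borel)"
      unfolding chi_def by measurable
    have "moment N S = (\<integral>y. chi S (to_path y) \<partial>lim)"
      unfolding moment_def N_def by (rule integral_distr[OF to_path]) simp
    also have "\<dots> = (\<integral>y. ?g (restrict y S) \<partial>lim)"
      by (intro Bochner_Integration.integral_cong refl chi_cong) (simp add: to_path_def)
    also have "\<dots> = (\<integral>y. ?g y \<partial>marginal c S)"
      unfolding marg[symmetric] by (rule integral_distr[OF res g, symmetric])
    also have "\<dots> = (\<Sum>W\<in>Pow S. c S W * ?g (spin_point S W))"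
      using S c_nonneg g by (rule integral_marginal)
    also have "\<dots> = (\<Sum>W\<in>Pow S. c S W * chi S (\<lambda>i. i \<in> W))"
    proof (intro sum.cong refl arg_cong2[of _ _ _ _ "(*)"] chi_cong)
      show "(0 < spin_point S W i) = (i \<in> W)" if "i \<in> S" for i W
        using that by (simp add: spin_point_def spin_def)
    qed
    finally have N_eq: "moment N S = (\<Sum>W\<in>Pow S. c S W * chi S (\<lambda>i. i \<in> W))" .
    have "chi S (\<lambda>i. i \<in> plus_sites S x) = chi S x" for x
      by (rule chi_cong) (simp add: plus_sites_def)
    then show ?thesis
      using trace_lim[OF S, of "\<lambda>W. chi S (\<lambda>i. i \<in> W)"] 
      unfolding N_eq by (simp add: moment_def)
  qed
  ultimately show thesis using that r(1) by blast
qed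

section \<open>Existence of a compatible law and its uniqueness under cancellation\<close>

context spin_mixture
begin

text \<open>Lags are almost surely positive, so the right-hand side of the recursion involves only
  sets without \<open>n\<close>, whose moments do not change under resampling at
  \<open>n\<close>.\<close>

lemma recursive_resample_same:
  assumes M: "law M"
  shows "recursive (moment (resample n M)) n"
  unfolding recursive_def
proof (intro allI impI)
  fix S assume S: "finite S" "S \<subseteq> {..<n}"
  have n: "n \<notin> S" "insert n S - {n} = S" using S by auto
  have "moment (resample n M) (toggle (n - int k) S) = moment M (toggle (n - int k) S)"
    if "k \<in> set_pmf \<kappa>" for k
  proof -
    have "k \<noteq> 0" using that zero_notin by metis
    then have "n \<notin> toggle (n - int k) S"
      using n by (auto simp: toggle_def)
    then show ?thesis using S(1) by (simp add: moment_resample[OF M])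
  qed
  then have "E (\<lambda>k. e k * moment (resample n M) (toggle (n - int k) S))
      = E (\<lambda>k. e k * moment M (toggle (n - int k) S))"
    by (intro integral_cong_AE) (simp_all add: AE_measure_pmf_iff)
  then show "moment (resample n M) (insert n S) = E (\<lambda>k. e k * moment (resample n M) (toggle (n - int k) S))"
    using moment_resample[OF M, of "insert n S" n] n S(1) by simp
qed

lemma recursive_resample_later:
  assumes M: "law M" and "recursive (moment M) m" "m < n"
  shows "recursive (moment (resample n M)) m"
  unfolding recursive_def
proof (intro allI impI)
  fix S assume S: "finite S" "S \<subseteq> {..<m}"
  have "n \<notin> toggle (m - int k) S" for k
    using S assms(3) by (auto simp: toggle_def)
  moreover have "n \<notin> insert m S" using S assms(3) by auto
  ultimately show "moment (resample n M) (insert m S) = E (\<lambda>k. e k * moment (resample n M) (toggle (m - int k) S))"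
    using assms(2) S moment_resample[OF M] by (simp add: recursive_def)
qed

text \<open>Starting from a point mass, the sites are resampled from left to right. Each resampled
  site gains its recursion, and the recursions at earlier sites stay intact because they do not
  involve the new site.\<close>

lemma exists_recursive_on_interval:
  obtains M where "law M" "\<And>i. i < j \<Longrightarrow> recursive (moment M) (a + int i)"
proof -
  have "\<exists>M. law M \<and> (\<forall>i<j. recursive (moment M) (a + int i))"
  proof (induction j)
    case 0
    have "law (return pathspace (\<lambda>_. True))"
      by (simp add: law_def prob_space_return)
    then show ?case by auto
  next
    case (Suc j)
    then obtain M where M: "law M" "\<And>i. i < j \<Longrightarrow> recursive (moment M) (a + int i)" by blast
    have "recursive (moment (resample (a + int j) M)) (a + int i)" if "i < Suc j" for i
      using that M recursive_resample_same recursive_resample_later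
      by (cases "i = j") auto
    then show ?case using law_resample[OF M(1)] by blast
  qed
  then show thesis using that by blast
qed

text \<open>For fixed \<open>n\<close> the recursion holds for all but finitely many of the
  approximating laws. It passes to the limit by dominated convergence over the lag, the moments
  being bounded by 1.\<close>

theorem exists_compatible: "\<exists>M. compatible kernel M"
proof -
  have "\<exists>M. law M \<and> (\<forall>i<2 * m + 1. recursive (moment M) (- int m + int i))" for m :: nat
    by (rule exists_recursive_on_interval[of "2 * m + 1" "- int m"]) blast
  then obtain M where M: "\<And>m. law (M m)" "\<And>m i. i < 2 * m + 1 \<Longrightarrow> recursive (moment (M m)) (- int m + int i)"
    by metis
  obtain r N where r: "strict_mono r" and N: "law N"
    and lim: "\<And>S. finite S \<Longrightarrow> (\<lambda>m. moment (M (r m)) S) \<longlonglongrightarrow> moment N S"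
    using law_subsequence[of M] M(1) by blast
  have rec: "recursive (moment (M m)) n" if "nat \<bar>n\<bar> \<le> m" for m n
  proof -
    have "nat (n + int m) < 2 * m + 1" "- int m + int (nat (n + int m)) = n" using that by auto
    then show ?thesis using M(2)[of "nat (n + int m)" m] by simp
  qed
  have "recursive (moment N) n" for n
    unfolding recursive_def
  proof (intro allI impI)
    fix S assume S: "finite S" "S \<subseteq> {..<n}"
    have "(\<lambda>m. E (\<lambda>k. e k * moment (M (r m)) (toggle (n - int k) S)))
        \<longlonglongrightarrow> E (\<lambda>k. e k * moment N (toggle (n - int k) S))"
    proof (rule integral_dominated_convergence[where w="\<lambda>_. 1"])
      show "AE k in measure_pmf \<kappa>. (\<lambda>m. e k * moment (M (r m)) (toggle (n - int k) S))
          \<longlonglongrightarrow> e k * moment N (toggle (n - int k) S)"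
        using S by (intro always_eventually allI tendsto_intros lim) simp
    qed (use abs_moment_le[OF M(1)] in auto)
    moreover have "\<forall>\<^sub>F m in sequentially. E (\<lambda>k. e k * moment (M (r m)) (toggle (n - int k) S))
        = moment (M (r m)) (insert n S)"
    proof (rule eventually_sequentiallyI)
      fix m assume "nat \<bar>n\<bar> \<le> m"
      then have "nat \<bar>n\<bar> \<le> r m" using seq_suble[OF r, of m] by simp
      from rec[OF this] S show "E (\<lambda>k. e k * moment (M (r m)) (toggle (n - int k) S)) = moment (M (r m)) (insert n S)"
        by (simp add: recursive_def)
    qed
    ultimately have "(\<lambda>m. moment (M (r m)) (insert n S)) \<longlonglongrightarrow> E (\<lambda>k. e k * moment N (toggle (n - int k) S))"
      by (rule Lim_transform_eventually)
    moreover have "(\<lambda>m. moment (M (r m)) (insert n S)) \<longlonglongrightarrow> moment N (insert n S)"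
      using S by (intro lim) simp
    ultimately show "moment N (insert n S) = E (\<lambda>k. e k * moment N (toggle (n - int k) S))"
      by (rule LIMSEQ_unique[rotated])
  qed
  then show ?thesis using N compatible_kernel_iff by blast
qed

theorem compatible_unique:
  assumes canc: "cancelling l1 l2" and gcd: "Gcd (set_pmf \<kappa>) = 1"
    and "compatible kernel M" "compatible kernel N"
  shows "M = N"
proof -
  have M: "law M" "\<And>n. recursive (moment M) n" and N: "law N" "\<And>n. recursive (moment N) n"
    using assms(3,4) by (auto simp: compatible_kernel_iff)
  \<comment> \<open>Halving keeps the difference within the bound 1 that
    \<open>recursive_eq_0\<close> asks for; at the empty set both moments are 1.\<close>
  define F where "F S = (moment M S - moment N S) / 2" for S
  have "recursive F n" for n
    unfolding recursive_def
  proof (intro allI impI)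
    fix S assume S: "finite S" "S \<subseteq> {..<n}"
    have "E (\<lambda>k. e k * F (toggle (n - int k) S))
        = (E (\<lambda>k. e k * moment M (toggle (n - int k) S)) - E (\<lambda>k. e k * moment N (toggle (n - int k) S))) / 2"
      using abs_moment_le[OF M(1)] abs_moment_le[OF N(1)]
      by (subst Bochner_Integration.integral_diff [symmetric])
         (auto simp: F_def algebra_simps intro!: integrable_bounded[where B=1] Bochner_Integration.integral_cong)
    then show "F (insert n S) = E (\<lambda>k. e k * F (toggle (n - int k) S))"
      using M(2)[of n] N(2)[of n] S by (simp add: recursive_def F_def)
  qed
  moreover have "\<bar>F S\<bar> \<le> 1" for S
    using abs_moment_le[OF M(1), of S] abs_moment_le[OF N(1), of S] by (simp add: F_def)
  moreover have "F {} = 0"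
    using M N by (simp add: F_def moment_empty)
  ultimately have "F S = 0" if "finite S" for S
    using recursive_eq_0[OF canc gcd] that by blast
  then show ?thesis
    using M N by (intro law_eqI) (auto simp: F_def)
qed

section \<open>Deterministic laws and the parity criterion\<close>

lemma moment_return: "moment (return pathspace x) S = chi S x"
  unfolding moment_def by (rule integral_return) auto

lemma compatible_return:
  assumes "\<And>n k. k \<in> set_pmf \<kappa> \<Longrightarrow> x n = (x (n - int k) = s k)"
  shows "compatible kernel (return pathspace x)"
  unfolding compatible_kernel_iff
proof (intro conjI allI)
  show "law (return pathspace x)"
    by (simp add: law_def prob_space_return)
  show "recursive (moment (return pathspace x)) n" for n
    unfolding recursive_def
  proof (intro allI impI)
    fix S assume S: "finite S" "S \<subseteq> {..<n}"
    have "E (\<lambda>k. e k * moment (return pathspace x) (toggle (n - int k) S)) = E (\<lambda>_. spin (x n) * chi S x)"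
    proof (intro integral_cong_AE, simp, simp, unfold AE_measure_pmf_iff, intro ballI)
      fix k assume "k \<in> set_pmf \<kappa>"
      then have "spin (x n) = spin (x (n - int k)) * e k"
        using assms[of k n] by (simp flip: spin_eq_iff)
      then show "e k * moment (return pathspace x) (toggle (n - int k) S) = spin (x n) * chi S x"
        using S by (simp add: moment_return chi_toggle)
    qed
    moreover have "n \<notin> S" using S by auto
    ultimately show "moment (return pathspace x) (insert n S) = E (\<lambda>k. e k * moment (return pathspace x) (toggle (n - int k) S))"
      using S by (simp add: moment_return chi_insert)
  qed
qed

text \<open>\<open>m1\<close> jumps of length \<open>m2\<close> cover the same distance as
  \<open>m2\<close> jumps of length \<open>m1\<close>. The first path has sign 1 because
  \<open>m1\<close> is even or lag \<open>m2\<close> copies; the second has sign -1 because it makes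
  an odd number of flips.\<close>

lemma cancellingI:
  assumes "m1 \<in> set_pmf \<kappa>" "m2 \<in> set_pmf \<kappa>" "odd m2" "\<not> s m1" "even m1 \<or> s m2"
  shows "cancelling (replicate m1 m2) (replicate m2 m1)"
proof -
  have "jump_sign (replicate m k) = e k ^ m" for m k
    by (induction m) (auto simp: jump_sign_def)
  then show ?thesis
    using assms by (auto simp: cancelling_def spin_def sum_list_replicate)
qed

theorem card_compatible_eq_1_iff:
  assumes gcd: "Gcd (set_pmf \<kappa>) = 1"
  shows "card (compatible_laws kernel) = 1 \<longleftrightarrow>
    (\<exists>m\<in>set_pmf \<kappa>. even m \<and> \<not> s m) \<or>
    (\<exists>m1\<in>set_pmf \<kappa>. \<exists>m2\<in>set_pmf \<kappa>. odd m1 \<and> odd m2 \<and> \<not> s m1 \<and> s m2)" (is "?L \<longleftrightarrow> ?R")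
proof
  assume ?R
  \<comment> \<open>An odd lag, present because the gcd is 1, is the partner of an even flipping
    lag.\<close>
  moreover have "\<exists>k\<in>set_pmf \<kappa>. odd k"
    using gcd Gcd_greatest[of "set_pmf \<kappa>" 2] by auto
  ultimately obtain l1 l2 where canc: "cancelling l1 l2"
    using cancellingI by metis
  obtain M where "compatible kernel M"
    using exists_compatible by blast
  then have "compatible_laws kernel = {M}"
    using compatible_unique[OF canc gcd] by (auto simp: compatible_laws_def)
  then show ?L by simp
next
  assume L: ?L
  show ?R
  proof (rule ccontr)
    assume R: "\<not> ?R"
    \<comment> \<open>Two paths obeying every lag are sought, told apart by their state at 0: the
      constant ones if all lags copy, the alternating ones if exactly the odd lags flip.\<close>
    have "\<exists>x. \<forall>b. x b (0::int) = b \<and> (\<forall>n. \<forall>k\<in>set_pmf \<kappa>. x b n = (x b (n - int k) = s k))"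
    proof (cases "\<forall>k\<in>set_pmf \<kappa>. s k")
      case True
      then show ?thesis by (intro exI[of _ "\<lambda>b _. b"]) auto
    next
      case False
      then have "s k = even k" if "k \<in> set_pmf \<kappa>" for k
        using R that by blast
      then show ?thesis by (intro exI[of _ "\<lambda>b n. even n = b"]) auto
    qed
    then obtain x where
      "\<forall>b. x b (0::int) = b \<and> (\<forall>n. \<forall>k\<in>set_pmf \<kappa>. x b n = (x b (n - int k) = s k))" ..
    then have x: "x b 0 = b" "k \<in> set_pmf \<kappa> \<Longrightarrow> x b n = (x b (n - int k) = s k)" for b n k
      by blast+
    have "return pathspace (x b) \<in> compatible_laws kernel" for b
      unfolding compatible_laws_def mem_Collect_eq by (rule compatible_return) (rule x(2))
    moreover have "return pathspace (x True) \<noteq> return pathspace (x False)"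
    proof
      assume "return pathspace (x True) = return pathspace (x False)"
      then have "chi {0} (x True) = chi {0} (x False)"
        using moment_return by metis
      then show False by (simp add: chi_def spin_def x(1))
    qed
    moreover obtain M where "compatible_laws kernel = {M}"
      using L by (rule card_1_singletonE)
    ultimately show False by (metis singletonD)
  qed
qed

end

theorem mainTheorem9:
  fixes A :: "nat set" and \<theta> :: "nat \<Rightarrow> real" and P :: "nat \<Rightarrow> bool \<Rightarrow> bool \<Rightarrow> real"
  assumes A_pos: "0 \<notin> A"
    and A_gcd: "Gcd A = 1"
    and \<theta>_pos: "\<And>k. k \<in> A \<Longrightarrow> \<theta> k > 0"
    and \<theta>_sum: "(\<theta> has_sum 1) A"
    and P_IJ: "\<And>k. k \<in> A \<Longrightarrow> P k = I2 \<or> P k = J2"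
  shows "card (compatible_laws (mixkernel A \<theta> P)) = 1 \<longleftrightarrow>
           ((\<exists>m\<in>A. even m \<and> P m = J2) \<or>
            (\<exists>m1\<in>A. \<exists>m2\<in>A. odd m1 \<and> odd m2 \<and> P m1 = J2 \<and> P m2 = I2))"
proof -
  \<comment> \<open>Extension by 0 gives a mass function on all naturals, whose support is exactly
    \<open>A\<close> because the weights on \<open>A\<close> are positive.\<close>
  define t where "t k = (if k \<in> A then \<theta> k else 0)" for k
  define \<kappa> where "\<kappa> = embed_pmf t"
  have t_nonneg: "0 \<le> t k" for k
    using \<theta>_pos by (simp add: t_def less_imp_le)
  have "(t has_sum 1) UNIV"
    using \<theta>_sum has_sum_cong_neutral[of A UNIV \<theta> t 1] by (simp add: t_def)
  then have "(\<Sum>k. ennreal (t k)) = ennreal 1"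
    by (intro suminf_ennreal_eq t_nonneg has_sum_imp_sums)
  then have "(\<integral>\<^sup>+ k. ennreal (t k) \<partial>count_space UNIV) = 1"
    unfolding nn_integral_count_space_nat by simp
  then have pmf: "pmf \<kappa> k = t k" for k
    unfolding \<kappa>_def using t_nonneg by (intro pmf_embed_pmf)
  have set: "set_pmf \<kappa> = A"
  proof (rule set_eqI)
    show "k \<in> set_pmf \<kappa> \<longleftrightarrow> k \<in> A" for k
      using \<theta>_pos[of k] by (auto simp: set_pmf_iff pmf t_def)
  qed
  have IJ: "I2 \<noteq> J2"
  proof
    assume "I2 = J2"
    then have "I2 True True = J2 True True" by (rule arg_cong)
    then show False by (simp add: I2_def J2_def)
  qed
  define s where "s k \<longleftrightarrow> P k = I2" for k
  interpret spin_mixture \<kappa> s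
    using A_pos by unfold_locales (simp add: set)
  have s_J: "\<not> s k \<longleftrightarrow> P k = J2" if "k \<in> A" for k
    using P_IJ[OF that] IJ by (auto simp: s_def)
  have "mixkernel A \<theta> P g w = kernel g w" for g w
  proof -
    have "kernel g w = infsetsum (\<lambda>k. pmf \<kappa> k * of_bool ((w k = s k) = g)) UNIV"
      unfolding kernel_def by (rule pmf_expectation_eq_infsetsum)
    also have "\<dots> = infsum (\<lambda>k. pmf \<kappa> k * of_bool ((w k = s k) = g)) UNIV"
      by (intro infsetsum_infsum abs_summable_on_comparison_test'[OF pmf_abs_summable[of \<kappa>]]) auto
    also have "\<dots> = infsum (\<lambda>k. \<theta> k * P k (w k) g) A"
    proof (rule infsum_cong_neutral)
      show "pmf \<kappa> k * of_bool ((w k = s k) = g) = \<theta> k * P k (w k) g" if "k \<in> UNIV \<inter> A" for k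
        using that P_IJ[of k] s_J[of k] by (auto simp: pmf t_def s_def I2_def J2_def)
    qed (auto simp: pmf t_def)
    finally show ?thesis by (simp add: mixkernel_def)
  qed
  then have "mixkernel A \<theta> P = kernel"
    by (intro ext)
  then have "card (compatible_laws (mixkernel A \<theta> P)) = 1 \<longleftrightarrow>
      (\<exists>m\<in>A. even m \<and> \<not> s m) \<or> (\<exists>m1\<in>A. \<exists>m2\<in>A. odd m1 \<and> odd m2 \<and> \<not> s m1 \<and> s m2)"
    using card_compatible_eq_1_iff A_gcd by (simp add: set)
  also have "\<dots> \<longleftrightarrow> (\<exists>m\<in>A. even m \<and> P m = J2) \<or>
      (\<exists>m1\<in>A. \<exists>m2\<in>A. odd m1 \<and> odd m2 \<and> P m1 = J2 \<and> P m2 = I2)"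
    using s_J s_def by blast
  finally show ?thesis .
qed

end
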